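(* Let $\bar x$ be feasible for the problem $\min_{x\in\mathbb{R}^n} f(x)$ subject to $F(x)\in\Omega$ and let $f$, $F$ be twice Fréchet differentiable at $\bar x$. If $\bar x$ is an essential local minimizer of second order, then for every critical direction $0\neq u\in\mathcal{C}(\bar x)$ there is some pair $(\lambda_0,\lambda)\in\mathbb{R}_+\times\mathbb{R}^m$ with $\lambda\in\Lambda^{\lambda_0}(\bar x;u)$ such that $$u^T\nabla_x^2\mathcal{L}(\bar x,\lambda_0,\lambda)u>0.\qquad( * )$$ Conversely, if for every critical direction $0\neq u\in\mathcal{C}(\bar x)$ there is some pair $(\lambda_0,\lambda)\in\mathbb{R}_+\times\mathbb{R}^m$ with $\lambda\in\hat\Lambda^{\lambda_0}(\bar x;u)$ fulfilling $( * )$, then $\bar x$ is an essential local minimizer of second order.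
   Context: Data: $f:\mathbb{R}^n\to\mathbb{R}$ and $F:\mathbb{R}^n\to\mathbb{R}^m$ are continuously differentiable, and $\Omega=\bigcup_{i=1}^{\bar p}P_i\subset\mathbb{R}^m$ is a union of finitely many convex polyhedra. $\nabla f(x)$ (row vector) and $\nabla F(x)$ denote Jacobians, $\nabla^2$ second derivatives. A feasible point $\bar x$ is an essential local minimizer of second order if there are a neighborhood $U$ of $\bar x$ and $\beta>0$ such that $\max\{f(x)-f(\bar x),{\rm d}(F(x),\Omega)\}\ge\beta\|x-\bar x\|^2$ for all $x\in U$. For a closed set $C\subset\mathbb{R}^d$ and $z\in C$: $T(z;C)=\{w : \exists\, w_k\to w,\ t_k\downarrow 0,\ z+t_kw_k\in C\}$ (contingent cone); $\hat N(z;C)=\{\xi : \limsup_{z'\to z,\ z'\in C}\xi^T(z'-z)/\|z'-z\|\le 0\}$ (Fréchet normal cone); both are $\emptyset$ if $z\notin C$. For $z\in C$ and $w\in\mathbb{R}^d$: $N(z;C;w)=\{\xi : \exists\, t_k\downarrow 0,\ w_k\to w,\ \xi_k\to\xi,\ \xi_k\in\hat N(z+t_kw_k;C)\ \forall k\}$ (Mordukhovich normal cone in direction $w$). Linearized cone: $T_{\rm lin}(\bar x)=\{u\in\mathbb{R}^n : \nabla F(\bar x)u\in T(F(\bar x);\Omega)\}$. Critical cone: $\mathcal{C}(\bar x)=\{u\in T_{\rm lin}(\bar x) : \nabla f(\bar x)u\le 0\}$. Directional metric subregularity: for $\rho,\delta>0$ let $V_{\rho,\delta}(u)=\{z : \|z\|\le\rho,\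 \big\|\,\|u\|z-\|z\|u\,\big\|\le\delta\|z\|\|u\|\}$. A multifunction $S$ is metrically subregular in direction $u$ at $(\bar x,\bar y)\in{\rm gph}\,S$ if there are $\rho,\delta,\kappa>0$ such that ${\rm d}(x,S^{-1}(\bar y))\le\kappa\,{\rm d}(\bar y,S(x))$ for all $x\in\bar x+V_{\rho,\delta}(u)$. Splitting (standing assumption): for each $u\in T_{\rm lin}(\bar x)$ the mapping $M(x)=F(x)-\Omega$ is split as $M=(M_1,M_2):\mathbb{R}^n\rightrightarrows\mathbb{R}^{m_1}\times\mathbb{R}^{m_2}$, $m=m_1+m_2$, $M_i(x)=F_i(x)-\Omega_i$, with $F=(F_1,F_2)$, $\Omega=\Omega_1\times\Omega_2$, each $F_i:\mathbb{R}^n\to\mathbb{R}^{m_i}$ continuously differentiable, each $\Omega_i$ a union of finitely many convex polyhedra, and $M_2$ metrically subregular in direction $u$ at $(\bar x,0)$. The splitting may depend on $u$; $m_2=0$ is allowed. Generalized Lagrangian: $\mathcal{L}(x,\lambda_0,\lambda)=\lambda_0f(x)+\lambda^TF(x)$. For $\lambda_0\ge 0$ and $u\in T_{\rm lin}(\bar x)$, $\Lambda^{\lambda_0}(\bar x;u)$ is the set of all $\lambda=(\lambda_1,\lambda_2)\in\mathbb{R}^{m_1}\times\mathbb{R}^{m_2}$ with $\lambda\in N(F(\bar x);\Omega;\nabla F(\bar x)u)$, $\nabla_x\mathcal{L}(\bar x,\lambda_0,\lambda)=0$, $\lambda_0+\|\lambda_1\|\neq 0$; and $\hat\Lambda^{\lambda_0}(\bar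 x;u)$ is the set of all such $\lambda$ with $\lambda\in\hat N(\nabla F(\bar x)u;T(F(\bar x);\Omega))$, $\nabla_x\mathcal{L}(\bar x,\lambda_0,\lambda)=0$, $\lambda_0+\|\lambda_1\|\neq 0$. *)

theory Defs
  imports "HOL-Analysis.Analysis"
begin

definition continuously_differentiable ::
    "('a::real_normed_vector \<Rightarrow> 'b::real_normed_vector) \<Rightarrow> bool" where
  "continuously_differentiable g \<longleftrightarrow>
     (\<exists>g'. (\<forall>x. (g has_derivative blinfun_apply (g' x)) (at x)) \<and> continuous_on UNIV g')"

definition twice_differentiable_at ::
    "('a::real_normed_vector \<Rightarrow> 'b::real_normed_vector) \<Rightarrow> 'a \<Rightarrow> bool" where
  "twice_differentiable_at g x \<longleftrightarrow>
     (\<exists>g'. (\<forall>\<^sub>F y in nhds x. (g has_derivative blinfun_apply (g' y)) (at y))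
          \<and> g' differentiable (at x))"

definition gradient :: "(real^'n \<Rightarrow> real) \<Rightarrow> real^'n \<Rightarrow> real^'n" where
  "gradient g x = (\<chi> i. frechet_derivative g (at x) (axis i 1))"

definition hessian :: "(real^'n \<Rightarrow> real) \<Rightarrow> real^'n \<Rightarrow> real^'n^'n" where
  "hessian g x = jacobian (gradient g) (at x)"

definition finite_union_polyhedra :: "'a::euclidean_space set \<Rightarrow> bool" where
  "finite_union_polyhedra C \<longleftrightarrow> (\<exists>\<P>. finite \<P> \<and> (\<forall>P\<in>\<P>. polyhedron P) \<and> C = \<Union>\<P>)"

definition contingent_cone :: "'a::real_inner \<Rightarrow> 'a set \<Rightarrow> 'a set" where
  "contingent_cone z C = (if z \<in> C
     then {w. \<exists>ws t. ws \<longlonglongrightarrow> w \<and> (\<forall>k. 0 < t k) \<and> t \<longlonglongrightarrow> (0::real)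
                \<and> (\<forall>k::nat. z + t k *\<^sub>R ws k \<in> C)}
     else {})"

definition frechet_normal_cone :: "'a::real_inner \<Rightarrow> 'a set \<Rightarrow> 'a set" where
  "frechet_normal_cone z C = (if z \<in> C
     then {\<xi>. Limsup (at z within C) (\<lambda>z'. ereal (\<xi> \<bullet> (z' - z) / norm (z' - z))) \<le> 0}
     else {})"

definition directional_normal_cone :: "'a::real_inner \<Rightarrow> 'a set \<Rightarrow> 'a \<Rightarrow> 'a set" where
  "directional_normal_cone z C w =
     {\<xi>. \<exists>t ws \<xi>s. (\<forall>k. 0 < t k) \<and> t \<longlonglongrightarrow> (0::real) \<and> ws \<longlonglongrightarrow> w \<and> \<xi>s \<longlonglongrightarrow> \<xi>
            \<and> (\<forall>k::nat. \<xi>s k \<in> frechet_normal_cone (z + t k *\<^sub>R ws k) C)}"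

definition directional_nbhd :: "real \<Rightarrow> real \<Rightarrow> 'a::real_normed_vector \<Rightarrow> 'a set" where
  "directional_nbhd \<rho> \<delta> u =
     {z. norm z \<le> \<rho> \<and> norm (norm u *\<^sub>R z - norm z *\<^sub>R u) \<le> \<delta> * norm z * norm u}"

(* The guard S x \<noteq> {} implements the convention that the distance to the empty set is
   infinite; infdist would return 0.  The other distance is to a set containing xbar. *)
definition metrically_subregular_in_direction ::
    "('a::real_normed_vector \<Rightarrow> 'b::real_normed_vector set) \<Rightarrow> 'a \<Rightarrow> 'a \<Rightarrow> 'b \<Rightarrow> bool" where
  "metrically_subregular_in_direction S u xbar ybar \<longleftrightarrow>
     ybar \<in> S xbar \<and>
     (\<exists>\<rho>>0. \<exists>\<delta>>0. \<exists>\<kappa>>0. \<forall>z\<in>directional_nbhd \<rho> \<delta> u.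
        S (xbar + z) \<noteq> {} \<longrightarrow>
        infdist (xbar + z) {x. ybar \<in> S x} \<le> \<kappa> * infdist ybar (S (xbar + z)))"

definition essential_local_minimizer_second_order ::
    "(real^'n \<Rightarrow> real) \<Rightarrow> (real^'n \<Rightarrow> real^'m) \<Rightarrow> (real^'m) set \<Rightarrow> real^'n \<Rightarrow> bool" where
  "essential_local_minimizer_second_order f F \<Omega> xbar \<longleftrightarrow>
     F xbar \<in> \<Omega> \<and>
     (\<exists>U. open U \<and> xbar \<in> U \<and>
       (\<exists>\<beta>>0. \<forall>x\<in>U. max (f x - f xbar) (infdist (F x) \<Omega>) \<ge> \<beta> * (norm (x - xbar))\<^sup>2))"

definition linearized_cone ::
    "(real^'n \<Rightarrow> real^'m) \<Rightarrow> (real^'m) set \<Rightarrow> real^'n \<Rightarrow> (real^'n) set" where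
  "linearized_cone F \<Omega> xbar =
     {u. jacobian F (at xbar) *v u \<in> contingent_cone (F xbar) \<Omega>}"

definition critical_cone ::
    "(real^'n \<Rightarrow> real) \<Rightarrow> (real^'n \<Rightarrow> real^'m) \<Rightarrow> (real^'m) set \<Rightarrow> real^'n \<Rightarrow> (real^'n) set" where
  "critical_cone f F \<Omega> xbar = {u \<in> linearized_cone F \<Omega> xbar. gradient f xbar \<bullet> u \<le> 0}"

(* A factorization of R^m into R^m1 x R^m2 is given by the set I of the coordinates that
   belong to the first factor, the second factor having the coordinates in - I.  Both factors
   are identified with coordinate subspaces of R^m: block I y is the component of y in the
   first factor and block (- I) y the one in the second.  m2 = 0 corresponds to I = UNIV. *)
definition block :: "'m set \<Rightarrow> real^'m \<Rightarrow> real^'m" where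
  "block I y = (\<chi> i. if i \<in> I then y $ i else 0)"

(* Smoothness of the parts block I \<circ> F and block (- I) \<circ> F follows from that of F. *)
definition admissible_splitting ::
    "(real^'n \<Rightarrow> real^'m) \<Rightarrow> (real^'m) set \<Rightarrow> real^'n \<Rightarrow> real^'n \<Rightarrow> 'm set \<Rightarrow> bool" where
  "admissible_splitting F \<Omega> xbar u I \<longleftrightarrow>
     (\<exists>\<Omega>\<^sub>1 \<Omega>\<^sub>2. \<Omega>\<^sub>1 \<subseteq> range (block I) \<and> finite_union_polyhedra \<Omega>\<^sub>1
        \<and> \<Omega>\<^sub>2 \<subseteq> range (block (- I)) \<and> finite_union_polyhedra \<Omega>\<^sub>2
        \<and> \<Omega> = {y. block I y \<in> \<Omega>\<^sub>1 \<and> block (- I) y \<in> \<Omega>\<^sub>2}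
        \<and> metrically_subregular_in_direction
             (\<lambda>x. {block (- I) (F x) - y | y. y \<in> \<Omega>\<^sub>2}) u xbar 0)"

definition lagrangian ::
    "(real^'n \<Rightarrow> real) \<Rightarrow> (real^'n \<Rightarrow> real^'m) \<Rightarrow> real^'n \<Rightarrow> real \<Rightarrow> real^'m \<Rightarrow> real" where
  "lagrangian f F x lam0 lam = lam0 * f x + lam \<bullet> F x"

definition multipliers ::
    "(real^'n \<Rightarrow> real) \<Rightarrow> (real^'n \<Rightarrow> real^'m) \<Rightarrow> (real^'m) set \<Rightarrow> 'm set \<Rightarrow> real \<Rightarrow>
     real^'n \<Rightarrow> real^'n \<Rightarrow> (real^'m) set" where
  "multipliers f F \<Omega> I lam0 xbar u =
     {lam. lam \<in> directional_normal_cone (F xbar) \<Omega> (jacobian F (at xbar) *v u)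
        \<and> gradient (\<lambda>x. lagrangian f F x lam0 lam) xbar = 0
        \<and> lam0 + norm (block I lam) \<noteq> 0}"

definition frechet_multipliers ::
    "(real^'n \<Rightarrow> real) \<Rightarrow> (real^'n \<Rightarrow> real^'m) \<Rightarrow> (real^'m) set \<Rightarrow> 'm set \<Rightarrow> real \<Rightarrow>
     real^'n \<Rightarrow> real^'n \<Rightarrow> (real^'m) set" where
  "frechet_multipliers f F \<Omega> I lam0 xbar u =
     {lam. lam \<in> frechet_normal_cone (jacobian F (at xbar) *v u) (contingent_cone (F xbar) \<Omega>)
        \<and> gradient (\<lambda>x. lagrangian f F x lam0 lam) xbar = 0
        \<and> lam0 + norm (block I lam) \<noteq> 0}"

end

theory Submission
  imports Defs
begin

text \<open>
  Near the ray from \<open>F xbar\<close> in direction \<open>\<nabla>F(xbar) u\<close> the set \<open>\<Omega>\<close> coincides with a translate of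
  a finite union \<open>R\<close> of polyhedral cones. Let \<open>c\<close>, \<open>A\<close> be the first derivatives of \<open>f\<close>, \<open>F\<close> at
  \<open>xbar\<close> and \<open>q0\<close>, \<open>q\<close> half their second derivatives along \<open>u\<close>. Quadratic growth along the arcs
  \<open>xbar + t u + t\<^sup>2 v\<close> with \<open>c u = 0\<close> forbids \<open>c v + q0 \<le> 0\<close>, \<open>A v + q \<in> R\<close>, so the point
  \<open>-(q0, q)\<close> lies outside the closed cone of all \<open>(c v + s, A v - z)\<close> with \<open>s \<ge> 0\<close>, \<open>z \<in> R\<close>. The
  residual of its projection onto this cone is a multiplier with positive second-order term (if
  \<open>c u < 0\<close>, drop the objective). Subregularity of the second block linearizes to an error bound,
  which makes a large penalty on that block exact; hence the multiplier does not vanish on the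
  first block and the objective simultaneously.

  Conversely, a sequence violating quadratic growth has a critical limit direction \<open>u\<close>. Since the
  Frechet multiplier is nonpositive on \<open>\<Omega> - F xbar\<close> along the sequence, the second-order
  expansion of the Lagrangian contradicts its positive curvature along \<open>u\<close>.
\<close>

subsection \<open>Radial cones of piecewise polyhedral sets\<close>

text \<open>Membership is asked along a whole initial segment, not along a sequence as in the
  contingent cone. In this form the cone commutes with finite intersections, and with finite unions
  of locally conic sets.\<close>

definition radial_cone :: "'a::real_normed_vector \<Rightarrow> 'a set \<Rightarrow> 'a set" where
  "radial_cone z C = {y. \<forall>\<^sub>F t in at_right 0. z + t *\<^sub>R y \<in> C}"

text \<open>The equivalence shrinks membership towards \<open>z\<close> and also non-membership, so
  \<open>z\<close> itself may lie outside \<open>C\<close>; a closed \<open>C\<close> missing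
  \<open>z\<close> satisfies it on a small ball where both sides fail.\<close>

definition locally_conic :: "'a::real_normed_vector \<Rightarrow> 'a set \<Rightarrow> bool" where
  "locally_conic z C \<longleftrightarrow>
     (\<exists>r>0. \<forall>w t. norm w < r \<longrightarrow> 0 < t \<longrightarrow> t \<le> 1 \<longrightarrow> (z + w \<in> C \<longleftrightarrow> z + t *\<^sub>R w \<in> C))"

lemma locally_conic_finite_family:
  assumes "finite \<F>" "\<And>C. C \<in> \<F> \<Longrightarrow> locally_conic z C"
  obtains r where "r > 0"
    "\<And>C w t. C \<in> \<F> \<Longrightarrow> norm w < r \<Longrightarrow> 0 < t \<Longrightarrow> t \<le> 1 \<Longrightarrow> z + w \<in> C \<longleftrightarrow> z + t *\<^sub>R w \<in> C"
proof -
  have "\<exists>r>0. \<forall>C\<in>\<F>. \<forall>w t. norm w < r \<longrightarrow> 0 < t \<longrightarrow> t \<le> 1 \<longrightarrow> (z + w \<in> C \<longleftrightarrow> z + t *\<^sub>R w \<in> C)"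
    using assms
  proof (induction \<F> rule: finite_induct)
    case empty
    show ?case by (auto intro: exI[of _ 1])
  next
    case (insert D \<F>)
    obtain r where r: "r > 0"
      "\<forall>C\<in>\<F>. \<forall>w t. norm w < r \<longrightarrow> 0 < t \<longrightarrow> t \<le> 1 \<longrightarrow> (z + w \<in> C \<longleftrightarrow> z + t *\<^sub>R w \<in> C)"
      using insert by blast
    obtain s where s: "s > 0"
      "\<forall>w t. norm w < s \<longrightarrow> 0 < t \<longrightarrow> t \<le> 1 \<longrightarrow> (z + w \<in> D \<longleftrightarrow> z + t *\<^sub>R w \<in> D)"
      using insert.prems[of D] unfolding locally_conic_def by blast
    show ?case
      using r s by (intro exI[of _ "min r s"]) auto
  qed
  then show ?thesis
    using that by blast
qed

lemma locally_conic_Union: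
  assumes "finite \<F>" "\<And>C. C \<in> \<F> \<Longrightarrow> locally_conic z C"
  shows "locally_conic z (\<Union>\<F>)"
proof -
  obtain r where "r > 0"
    "\<And>C w t. C \<in> \<F> \<Longrightarrow> norm w < r \<Longrightarrow> 0 < t \<Longrightarrow> t \<le> 1 \<Longrightarrow> z + w \<in> C \<longleftrightarrow> z + t *\<^sub>R w \<in> C"
    using locally_conic_finite_family[OF assms] by blast
  then show ?thesis
    unfolding locally_conic_def by (intro exI[of _ r]) blast
qed

lemma locally_conic_Inter:
  assumes "finite \<F>" "\<And>C. C \<in> \<F> \<Longrightarrow> locally_conic z C"
  shows "locally_conic z (\<Inter>\<F>)"
proof -
  obtain r where "r > 0"
    "\<And>C w t. C \<in> \<F> \<Longrightarrow> norm w < r \<Longrightarrow> 0 < t \<Longrightarrow> t \<le> 1 \<Longrightarrow> z + w \<in> C \<longleftrightarrow> z + t *\<^sub>R w \<in> C"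
    using locally_conic_finite_family[OF assms] by blast
  then show ?thesis
    unfolding locally_conic_def by (intro exI[of _ r]) blast
qed

lemma norm_scaleR_less:
  assumes "norm w < r" "0 < t" "t \<le> 1"
  shows "norm (t *\<^sub>R w) < r"
proof -
  have "t * norm w \<le> 1 * norm w"
    using assms by (intro mult_right_mono) auto
  then show ?thesis
    using assms by simp
qed

text \<open>If \<open>a \<bullet> z\<close> differs from \<open>b\<close>, a whole ball around
  \<open>z\<close> lies on one side of the bounding hyperplane. If they are equal, membership of
  \<open>z + w\<close> reads \<open>a \<bullet> w \<le> 0\<close>, which is invariant under positive
  scaling.\<close>

lemma locally_conic_halfspace: "locally_conic z {x::'a::euclidean_space. a \<bullet> x \<le> b}"
proof -
  consider "a \<bullet> z < b" | "a \<bullet> z = b" | "a \<bullet> z > b"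
    by linarith
  then show ?thesis
  proof cases
    case 1
    then have "z \<in> {x. a \<bullet> x < b}"
      by simp
    then obtain r where r: "r > 0" "ball z r \<subseteq> {x. a \<bullet> x < b}"
      using openE[OF open_halfspace_lt] by metis
    have "a \<bullet> (z + w) \<le> b" if "norm w < r" for w
    proof -
      have "z + w \<in> ball z r" using that by (simp add: dist_norm)
      then show ?thesis using r by force
    qed
    then show ?thesis
      unfolding locally_conic_def using r(1) by (intro exI[of _ r]) (simp add: norm_scaleR_less del: norm_scaleR)
  next
    case 2
    then show ?thesis
      unfolding locally_conic_def by (auto simp: inner_add_right mult_le_0_iff intro!: exI[of _ 1])
  next
    case 3
    then have "z \<in> {x. a \<bullet> x > b}"
      by simp
    then obtain r where r: "r > 0" "ball z r \<subseteq> {x. a \<bullet> x > b}"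
      using openE[OF open_halfspace_gt] by metis
    have "a \<bullet> (z + w) > b" if "norm w < r" for w
    proof -
      have "z + w \<in> ball z r" using that by (simp add: dist_norm)
      then show ?thesis using r by force
    qed
    then have "\<not> a \<bullet> (z + w) \<le> b" if "norm w < r" for w
      using that by (simp add: not_le)
    then show ?thesis
      unfolding locally_conic_def using r(1) by (intro exI[of _ r]) (simp add: norm_scaleR_less del: norm_scaleR)
  qed
qed

lemma locally_conic_polyhedron:
  fixes P :: "'a::euclidean_space set"
  assumes "polyhedron P"
  shows "locally_conic z P"
proof -
  obtain \<F> where "finite \<F>" "P = \<Inter>\<F>" "\<forall>h\<in>\<F>. \<exists>a b. a \<noteq> 0 \<and> h = {x. a \<bullet> x \<le> b}"
    using assms unfolding polyhedron_def by blast
  then show ?thesis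
    using locally_conic_halfspace by (fastforce intro!: locally_conic_Inter)
qed

lemma finite_union_polyhedra_locally_conic:
  "finite_union_polyhedra C \<Longrightarrow> locally_conic z C"
  unfolding finite_union_polyhedra_def by (metis locally_conic_Union locally_conic_polyhedron)

lemma finite_union_polyhedra_closed: "finite_union_polyhedra C \<Longrightarrow> closed C"
  unfolding finite_union_polyhedra_def by (auto intro: polyhedron_imp_closed)

lemma locally_conic_radial_cone:
  assumes "locally_conic z C"
  obtains r where "r > 0" "\<And>w. norm w < r \<Longrightarrow> z + w \<in> C \<longleftrightarrow> w \<in> radial_cone z C"
    "\<And>w t. norm w < r \<Longrightarrow> 0 < t \<Longrightarrow> t \<le> 1 \<Longrightarrow> z + w \<in> C \<longleftrightarrow> z + t *\<^sub>R w \<in> C"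
proof -
  obtain r where r: "r > 0"
    "\<And>w t. norm w < r \<Longrightarrow> 0 < t \<Longrightarrow> t \<le> 1 \<Longrightarrow> z + w \<in> C \<longleftrightarrow> z + t *\<^sub>R w \<in> C"
    using assms unfolding locally_conic_def by blast
  have "z + w \<in> C \<longleftrightarrow> w \<in> radial_cone z C" if w: "norm w < r" for w
  proof
    assume "z + w \<in> C"
    then have "\<forall>t>0. t < 1 \<longrightarrow> z + t *\<^sub>R w \<in> C"
      using r(2)[OF w] by simp
    then show "w \<in> radial_cone z C"
      unfolding radial_cone_def eventually_at_right_field by (auto intro!: exI[of _ 1])
  next
    assume "w \<in> radial_cone z C"
    then obtain b where b: "b > 0" "\<And>t. 0 < t \<Longrightarrow> t < b \<Longrightarrow> z + t *\<^sub>R w \<in> C"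
      unfolding radial_cone_def eventually_at_right_field by auto
    \<comment> \<open>This factor is below \<open>b\<close>, so the segment condition applies, and
      at most 1, so local conicity transports membership back to \<open>z + w\<close>.\<close>
    have "z + min 1 (b/2) *\<^sub>R w \<in> C"
      using b by (intro b(2)) (auto simp: min_def)
    then show "z + w \<in> C"
      using r(2)[OF w, of "min 1 (b/2)"] b(1) by simp
  qed
  then show ?thesis
    using r that by blast
qed

lemma radial_cone_scaleR:
  assumes "y \<in> radial_cone z C" "c > 0"
  shows "c *\<^sub>R y \<in> radial_cone z C"
proof -
  obtain b where b: "b > 0" "\<And>t. 0 < t \<Longrightarrow> t < b \<Longrightarrow> z + t *\<^sub>R y \<in> C"
    using assms(1) unfolding radial_cone_def eventually_at_right_field by auto
  have "z + t *\<^sub>R c *\<^sub>R y \<in> C" if "0 < t" "t < b / c" for t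
    using b(2)[of "t * c"] that assms(2) by (simp add: pos_less_divide_eq)
  then show ?thesis
    using b(1) assms(2) unfolding radial_cone_def eventually_at_right_field
    by (auto intro!: exI[of _ "b / c"])
qed

lemma radial_cone_scaleR_iff:
  "c > 0 \<Longrightarrow> c *\<^sub>R y \<in> radial_cone z C \<longleftrightarrow> y \<in> radial_cone z C"
  using radial_cone_scaleR[of y z C c] radial_cone_scaleR[of "c *\<^sub>R y" z C "inverse c"] by auto

lemma zero_mem_radial_cone [simp]: "0 \<in> radial_cone z C \<longleftrightarrow> z \<in> C"
  by (simp add: radial_cone_def)

lemma cone_radial_cone: "z \<in> C \<Longrightarrow> cone (radial_cone z C)"
  unfolding cone_def using radial_cone_scaleR
  by (metis less_eq_real_def scaleR_zero_left zero_mem_radial_cone)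

lemma radial_cone_eq_empty:
  assumes "closed C" "z \<notin> C"
  shows "radial_cone z C = {}"
proof -
  have "z \<in> C" if "y \<in> radial_cone z C" for y
  proof (rule Lim_in_closed_set[OF assms(1)])
    show "\<forall>\<^sub>F t in at_right 0. z + t *\<^sub>R y \<in> C"
      using that by (simp add: radial_cone_def)
    show "((\<lambda>t. z + t *\<^sub>R y) \<longlongrightarrow> z) (at_right 0)"
      by (auto intro!: tendsto_eq_intros)
  qed simp
  then show ?thesis
    using assms(2) by blast
qed

text \<open>A priori the member of the family containing \<open>z + t y\<close> may change with
  \<open>t\<close>. One sufficiently small \<open>t\<close> selects a member, and local conicity
  with a common radius keeps all shorter points of the segment in it.\<close>

lemma radial_cone_Union:
  assumes "finite \<F>" "\<And>C. C \<in> \<F> \<Longrightarrow> locally_conic z C"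
  shows "radial_cone z (\<Union>\<F>) = (\<Union>C\<in>\<F>. radial_cone z C)"
proof
  show "(\<Union>C\<in>\<F>. radial_cone z C) \<subseteq> radial_cone z (\<Union>\<F>)"
    unfolding radial_cone_def by (auto elim!: eventually_mono)
  show "radial_cone z (\<Union>\<F>) \<subseteq> (\<Union>C\<in>\<F>. radial_cone z C)"
  proof
    fix y assume y: "y \<in> radial_cone z (\<Union>\<F>)"
    obtain r where r: "r > 0"
      "\<And>C w t. C \<in> \<F> \<Longrightarrow> norm w < r \<Longrightarrow> 0 < t \<Longrightarrow> t \<le> 1 \<Longrightarrow> z + w \<in> C \<longleftrightarrow> z + t *\<^sub>R w \<in> C"
      using locally_conic_finite_family[OF assms] by blast
    have "((\<lambda>t. norm (t *\<^sub>R y)) \<longlongrightarrow> 0) (at_right 0)"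
      by (auto intro!: tendsto_eq_intros)
    then have "\<forall>\<^sub>F t in at_right 0. norm (t *\<^sub>R y) < r"
      using r(1) by (rule order_tendstoD)
    moreover have "\<forall>\<^sub>F t in at_right 0. z + t *\<^sub>R y \<in> \<Union>\<F>"
      using y by (simp add: radial_cone_def)
    moreover have "\<forall>\<^sub>F t in at_right 0. (0::real) < t"
      by (simp add: eventually_at_right_less)
    ultimately have "\<forall>\<^sub>F t in at_right 0. norm (t *\<^sub>R y) < r \<and> z + t *\<^sub>R y \<in> \<Union>\<F> \<and> 0 < t"
      by eventually_elim simp
    then obtain t where t: "norm (t *\<^sub>R y) < r" "z + t *\<^sub>R y \<in> \<Union>\<F>" "0 < t"
      using eventually_happens[of _ "at_right (0::real)"] by force
    then obtain C where C: "C \<in> \<F>" "z + t *\<^sub>R y \<in> C"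
      by blast
    have "z + s *\<^sub>R y \<in> C" if "0 < s" "s < t" for s
      using r(2)[OF C(1) t(1), of "s / t"] that C(2) t(3) by simp
    then have "y \<in> radial_cone z C"
      using t(3) unfolding radial_cone_def eventually_at_right_field by auto
    then show "y \<in> (\<Union>C\<in>\<F>. radial_cone z C)"
      using C(1) by blast
  qed
qed

lemma radial_cone_halfspace:
  fixes a :: "'a::euclidean_space"
  shows "radial_cone z {x. a \<bullet> x \<le> b} =
    (if a \<bullet> z < b then UNIV else if a \<bullet> z = b then {y. a \<bullet> y \<le> 0} else {})"
proof -
  have "radial_cone z {x. a \<bullet> x \<le> b} = UNIV" if "a \<bullet> z < b"
  proof -
    have "\<forall>\<^sub>F t in at_right (0::real). a \<bullet> (z + t *\<^sub>R y) < b" for y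
    proof (rule order_tendstoD)
      show "((\<lambda>t. a \<bullet> (z + t *\<^sub>R y)) \<longlongrightarrow> a \<bullet> z) (at_right 0)"
        by (auto intro!: tendsto_eq_intros)
    qed fact
    then show ?thesis
      unfolding radial_cone_def mem_Collect_eq
      by (metis (mono_tags, lifting) UNIV_eq_I eventually_mono less_imp_le mem_Collect_eq)
  qed
  moreover have "radial_cone z {x. a \<bullet> x \<le> b} = {y. a \<bullet> y \<le> 0}" if "a \<bullet> z = b"
  proof -
    have "(\<forall>\<^sub>F t in at_right 0. a \<bullet> (z + t *\<^sub>R y) \<le> b) \<longleftrightarrow> (\<forall>\<^sub>F t in at_right (0::real). a \<bullet> y \<le> 0)" for y
      using that by (intro eventually_cong[OF eventually_at_right_less])
        (auto simp: inner_add_right mult_le_0_iff)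
    then show ?thesis
      unfolding radial_cone_def by simp
  qed
  moreover have "radial_cone z {x. a \<bullet> x \<le> b} = {}" if "a \<bullet> z > b"
    using that by (intro radial_cone_eq_empty closed_halfspace_le) auto
  ultimately show ?thesis
    by auto
qed

lemma radial_cone_Inter:
  assumes "finite \<F>"
  shows "radial_cone z (\<Inter>\<F>) = (\<Inter>C\<in>\<F>. radial_cone z C)"
  unfolding radial_cone_def using assms by (auto simp: eventually_ball_finite_distrib)

lemma polyhedron_radial_cone:
  fixes P :: "'a::euclidean_space set"
  assumes "polyhedron P"
  shows "polyhedron (radial_cone z P)"
proof -
  obtain \<F> where \<F>: "finite \<F>" "P = \<Inter>\<F>" "\<forall>h\<in>\<F>. \<exists>a b. a \<noteq> 0 \<and> h = {x. a \<bullet> x \<le> b}"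
    using assms unfolding polyhedron_def by blast
  have "polyhedron (radial_cone z h)" if h_mem: "h \<in> \<F>" for h
  proof -
    obtain a b where h: "h = {x. a \<bullet> x \<le> b}"
      using bspec[OF \<F>(3) h_mem] by blast
    show ?thesis
      unfolding h radial_cone_halfspace by (auto simp: polyhedron_halfspace_le)
  qed
  then show ?thesis
    unfolding \<F>(2) radial_cone_Inter[OF \<F>(1)] using \<F>(1) by (intro polyhedron_Inter) auto
qed

lemma radial_cone_finite_union_polyhedral_cones:
  fixes C :: "'a::euclidean_space set"
  assumes "finite_union_polyhedra C"
  obtains \<P> where "finite \<P>" "radial_cone z C = \<Union>\<P>" "\<And>P. P \<in> \<P> \<Longrightarrow> polyhedron P \<and> cone P"
proof -
  obtain \<F> where \<F>: "finite \<F>" "\<forall>P\<in>\<F>. polyhedron P" "C = \<Union>\<F>"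
    using assms unfolding finite_union_polyhedra_def by blast
  have cone: "cone (radial_cone z P)" if "polyhedron P" for P
    using that cone_radial_cone[of z P] radial_cone_eq_empty[of P z]
    by (metis cone_empty polyhedron_imp_closed)
  show ?thesis
  proof (rule that)
    show "finite (radial_cone z ` \<F>)"
      using \<F>(1) by simp
    show "radial_cone z C = \<Union>(radial_cone z ` \<F>)"
      using \<F> radial_cone_Union[of \<F> z] locally_conic_polyhedron by blast
    show "polyhedron Q \<and> cone Q" if "Q \<in> radial_cone z ` \<F>" for Q
      using that \<F>(2) cone polyhedron_radial_cone by (metis imageE)
  qed
qed

lemma finite_union_polyhedra_radial_cone:
  fixes C :: "'a::euclidean_space set"
  assumes "finite_union_polyhedra C"
  shows "finite_union_polyhedra (radial_cone z C)"
  using radial_cone_finite_union_polyhedral_cones[OF assms, of z]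
  unfolding finite_union_polyhedra_def by metis

text \<open>Near \<open>z\<close> the set is a translate of its radial cone, so the vectors
  \<open>ws k\<close> of a contingent sequence eventually lie in that cone. It is again a finite
  union of polyhedra, hence closed, and contains the limit.\<close>

lemma contingent_cone_eq_radial_cone:
  fixes C :: "'a::euclidean_space set"
  assumes "finite_union_polyhedra C" "z \<in> C"
  shows "contingent_cone z C = radial_cone z C"
proof
  obtain r where r: "r > 0" "\<And>w. norm w < r \<Longrightarrow> z + w \<in> C \<longleftrightarrow> w \<in> radial_cone z C"
    using locally_conic_radial_cone[OF finite_union_polyhedra_locally_conic[OF assms(1)]] by metis
  show "contingent_cone z C \<subseteq> radial_cone z C"
  proof
    fix w assume "w \<in> contingent_cone z C"
    then obtain ws t where w: "ws \<longlonglongrightarrow> w" "\<forall>k. 0 < t k" "t \<longlonglongrightarrow> (0::real)"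
      "\<forall>k::nat. z + t k *\<^sub>R ws k \<in> C"
      using assms(2) unfolding contingent_cone_def by auto
    have "(\<lambda>k. norm (t k *\<^sub>R ws k)) \<longlonglongrightarrow> norm (0 *\<^sub>R w)"
      by (intro tendsto_intros w)
    then have "(\<lambda>k. norm (t k *\<^sub>R ws k)) \<longlonglongrightarrow> 0"
      by simp
    then have "\<forall>\<^sub>F k in sequentially. norm (t k *\<^sub>R ws k) < r"
      using r(1) by (rule order_tendstoD)
    then have "\<forall>\<^sub>F k in sequentially. ws k \<in> radial_cone z C"
    proof eventually_elim
      case (elim k)
      then have "t k *\<^sub>R ws k \<in> radial_cone z C"
        using r(2) w(4) by blast
      then show ?case
        using w(2) radial_cone_scaleR_iff by blast
    qed
    then show "w \<in> radial_cone z C"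
      using finite_union_polyhedra_closed[OF finite_union_polyhedra_radial_cone[OF assms(1)]]
        w(1) by (metis Lim_in_closed_set sequentially_bot)
  qed
  show "radial_cone z C \<subseteq> contingent_cone z C"
  proof
    fix w assume "w \<in> radial_cone z C"
    then obtain b where b: "b > 0" "\<And>t. 0 < t \<Longrightarrow> t < b \<Longrightarrow> z + t *\<^sub>R w \<in> C"
      unfolding radial_cone_def eventually_at_right_field by auto
    \<comment> \<open>The constant sequence \<open>w\<close> with these step sizes, all inside the
      admissible interval below \<open>b\<close>, witnesses contingency.\<close>
    define t where "t k = b / 2 / real (Suc k)" for k
    have "t \<longlonglongrightarrow> 0"
      unfolding t_def by (intro tendsto_divide_0[OF tendsto_const] filterlim_compose[OF filterlim_real_sequentially filterlim_Suc] filterlim_at_top_imp_at_infinity)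
    moreover have "0 < t k" "t k < b" for k
      using b(1) by (auto simp: t_def field_simps add_pos_nonneg)
    ultimately show "w \<in> contingent_cone z C"
      unfolding contingent_cone_def using assms(2) b(2)
      by (auto intro!: exI[of _ "\<lambda>_. w"] exI[of _ t])
  qed
qed

subsection \<open>Projection onto linear images of polyhedral cones\<close>

lemma polyhedron_linear_vimage:
  fixes f :: "'a::euclidean_space \<Rightarrow> 'b::euclidean_space"
  assumes "linear f" "polyhedron P"
  shows "polyhedron (f -` P)"
proof -
  obtain \<F> where \<F>: "finite \<F>" "P = \<Inter>\<F>" "\<forall>h\<in>\<F>. \<exists>a b. a \<noteq> 0 \<and> h = {x. a \<bullet> x \<le> b}"
    using assms(2) unfolding polyhedron_def by blast
  have "polyhedron (f -` h)" if h_mem: "h \<in> \<F>" for h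
  proof -
    obtain a b where h: "h = {x. a \<bullet> x \<le> b}"
      using bspec[OF \<F>(3) h_mem] by blast
    have "f -` h = {x. adjoint f a \<bullet> x \<le> b}"
      unfolding h using adjoint_works[OF assms(1)] by (auto simp: inner_commute)
    then show ?thesis
      by (simp add: polyhedron_halfspace_le)
  qed
  moreover have "f -` P = \<Inter>((-`) f ` \<F>)"
    using \<F>(2) by auto
  ultimately show ?thesis
    using \<F>(1) by auto
qed

text \<open>Intersecting with a box around the origin yields a polytope, which is the hull of
  finitely many points. Every element of the cone can be scaled into the box, so these points
  generate the cone.\<close>

lemma polyhedral_cone_finitely_generated:
  fixes P :: "'a::euclidean_space set"
  assumes "polyhedron P" "cone P" "P \<noteq> {}"
  obtains S where "finite S" "P = convex_cone hull S"
proof -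
  let ?B = "cbox (-One) One :: 'a set"
  have "polytope (P \<inter> ?B)"
    using assms(1) by (simp add: polytope_eq_bounded_polyhedron bounded_Int)
  then obtain S where S: "finite S" "P \<inter> ?B = convex hull S"
    unfolding polytope_def by blast
  have "P = convex_cone hull S"
  proof
    show "P \<subseteq> convex_cone hull S"
    proof
      fix x assume x: "x \<in> P"
      \<comment> \<open>Dividing by \<open>c\<close> bounds every coordinate by 1 in absolute value;
        the summand 1 keeps \<open>c\<close> positive also for \<open>x = 0\<close>.\<close>
      define c where "c = 1 + norm x"
      have c: "c > 0"
        by (simp add: c_def add_pos_nonneg)
      have "inverse c *\<^sub>R x \<in> ?B"
      proof -
        have "- c \<le> x \<bullet> i" "x \<bullet> i \<le> c" if "i \<in> Basis" for i
          using Basis_le_norm[OF that, of x] by (auto simp: c_def)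
        then show ?thesis
          using c by (auto simp: mem_box field_simps)
      qed
      moreover have "inverse c *\<^sub>R x \<in> P"
        using assms(2) x c by (simp add: cone_def)
      ultimately have "inverse c *\<^sub>R x \<in> convex_cone hull S"
        using S(2) convex_hull_subset_convex_cone_hull by blast
      then have "c *\<^sub>R inverse c *\<^sub>R x \<in> convex_cone hull S"
        using c convex_cone_hull_mul by (metis less_imp_le)
      then show "x \<in> convex_cone hull S"
        using c by simp
    qed
    have "convex_cone P"
      unfolding convex_cone_def conic_def using assms polyhedron_imp_convex
      by (auto simp: cone_def)
    moreover have "S \<subseteq> P"
      using S(2) hull_subset[of S convex] by blast
    ultimately show "convex_cone hull S \<subseteq> P"
      by (rule hull_minimal[rotated])
  qed
  then show ?thesis
    using that S(1) by blast
qed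

text \<open>A linear image of a finitely generated cone is finitely generated and therefore closed.
  Linear images of general closed convex cones may fail to be closed, so polyhedrality is what
  guarantees that projections exist later.\<close>

lemma closed_linear_image_polyhedral_cone:
  fixes f :: "'a::euclidean_space \<Rightarrow> 'b::euclidean_space"
  assumes "linear f" "polyhedron P" "cone P"
  shows "closed (f ` P)"
proof (cases "P = {}")
  case False
  then obtain S where "finite S" "P = convex_cone hull S"
    using polyhedral_cone_finitely_generated[OF assms(2,3)] by blast
  then show ?thesis
    using assms(1) by (simp flip: convex_cone_hull_linear_image add: closed_convex_cone_hull)
qed simp

text \<open>Expanding the squared norms gives 0 \<le> \<epsilon> (2 p \<bullet> d + \<epsilon> d
  \<bullet> d); divide by \<epsilon> and let it tend to 0.\<close>

lemma inner_nonneg_of_norm_minimal: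
  fixes p d :: "'a::real_inner"
  assumes "\<And>\<epsilon>. 0 < \<epsilon> \<Longrightarrow> \<epsilon> < 1 \<Longrightarrow> norm p \<le> norm (p + \<epsilon> *\<^sub>R d)"
  shows "p \<bullet> d \<ge> 0"
proof -
  have "((\<lambda>\<epsilon>. 2 * (p \<bullet> d) + \<epsilon> * (d \<bullet> d)) \<longlongrightarrow> 2 * (p \<bullet> d)) (at_right 0)"
    by (auto intro!: tendsto_eq_intros)
  moreover have "2 * (p \<bullet> d) + \<epsilon> * (d \<bullet> d) \<ge> 0" if "0 < \<epsilon>" "\<epsilon> < 1" for \<epsilon>
  proof -
    have "p \<bullet> p \<le> (p + \<epsilon> *\<^sub>R d) \<bullet> (p + \<epsilon> *\<^sub>R d)"
      using assms[OF that] by (simp add: norm_le)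
    then have "0 \<le> \<epsilon> * (2 * (p \<bullet> d) + \<epsilon> * (d \<bullet> d))"
      by (simp add: inner_add_left inner_add_right inner_commute algebra_simps)
    then show ?thesis
      using that(1) by (simp add: zero_le_mult_iff)
  qed
  then have "\<forall>\<^sub>F \<epsilon> in at_right 0. 2 * (p \<bullet> d) + \<epsilon> * (d \<bullet> d) \<ge> 0"
    unfolding eventually_at_right_field by (auto intro!: exI[of _ 1])
  ultimately have "0 \<le> 2 * (p \<bullet> d)"
    by (intro tendsto_lowerbound[of _ _ "at_right 0"]) auto
  then show ?thesis by simp
qed

text \<open>The pair \<open>(lam0, w)\<close> is the residual of a nearest point, seen from
  \<open>(-q0, - S q)\<close>, in the cone of all \<open>(c \<bullet> v + s, S (A v - z))\<close>
  with \<open>s \<ge> 0\<close> and \<open>z \<in> R\<close>. This cone is a finite union of closed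
  convex cones and need not be convex, so normality to \<open>R\<close> at \<open>z\<close> appears
  only as a proximal inequality with a quadratic error. The last conclusion records minimality for
  later comparison with competitors.\<close>

lemma projection_multiplier:
  fixes A :: "'a::euclidean_space \<Rightarrow> 'b::euclidean_space" and S :: "'b \<Rightarrow> 'b"
    and c :: 'a and q0 :: real and q :: 'b and \<P> :: "'b set set"
  defines "R \<equiv> \<Union>\<P>"
  assumes A: "linear A" and S: "linear S" "inj S"
    and \<P>: "finite \<P>" "\<forall>P\<in>\<P>. polyhedron P \<and> cone P" and "R \<noteq> {}"
    and infeasible: "\<forall>v. A v + q \<in> R \<longrightarrow> c \<bullet> v + q0 > 0"
  obtains v z lam0 w where "z \<in> R" "w = S (A v + q - z)" "lam0 \<ge> 0" "c \<bullet> v + q0 \<le> lam0"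
    "\<forall>h. lam0 * (c \<bullet> h) + w \<bullet> S (A h) = 0"
    "lam0 * q0 + w \<bullet> S q > 0"
    "\<forall>y\<in>R. w \<bullet> S (y - z) \<le> (norm (S (y - z)))\<^sup>2 / 2"
    "\<forall>v'. \<forall>z'\<in>R.
       lam0\<^sup>2 + (norm w)\<^sup>2 \<le> (max 0 (c \<bullet> v' + q0))\<^sup>2 + (norm (S (A v' + q - z')))\<^sup>2"
proof -
  interpret A: linear A by (fact A)
  interpret S: linear S by (fact S(1))
  \<comment> \<open>Treating the slack and the element of \<open>R\<close> as further variables
    turns \<open>E\<close> into a finite union of linear images of polyhedral cones.\<close>
  define g :: "'a \<times> real \<times> 'b \<Rightarrow> real \<times> 'b"
    where "g = (\<lambda>(v, s, z). (c \<bullet> v + s, S (A v - z)))"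
  have g: "linear g"
    unfolding g_def
    by (auto intro!: linearI simp: A.add A.scale S.add S.diff S.scale inner_add_right algebra_simps)
  define D where "D P = {x :: 'a \<times> real \<times> 'b. 0 \<le> fst (snd x) \<and> snd (snd x) \<in> P}" for P
  define E where "E = (\<Union>P\<in>\<P>. g ` D P)"
  have "closed (g ` D P)" if "P \<in> \<P>" for P
  proof (rule closed_linear_image_polyhedral_cone[OF g])
    have "D P = {x. (0, 1, 0) \<bullet> x \<ge> 0} \<inter> (snd \<circ> snd) -` P"
      by (auto simp: D_def)
    moreover have "polyhedron ((snd \<circ> snd :: 'a \<times> real \<times> 'b \<Rightarrow> 'b) -` P)"
      using bspec[OF \<P>(2) that] by (intro polyhedron_linear_vimage linear_compose linear_snd) auto
    ultimately show "polyhedron (D P)"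
      by (simp add: polyhedron_halfspace_ge)
    show "cone (D P)"
      using bspec[OF \<P>(2) that] by (auto simp: D_def cone_def)
  qed
  then have "closed E"
    unfolding E_def using \<P>(1) by auto
  have memE: "e \<in> E \<longleftrightarrow> (\<exists>v s z. 0 \<le> s \<and> z \<in> R \<and> e = (c \<bullet> v + s, S (A v - z)))" for e
  proof -
    have "e \<in> E \<longleftrightarrow> (\<exists>P\<in>\<P>. \<exists>v s z. 0 \<le> s \<and> z \<in> P \<and> e = (c \<bullet> v + s, S (A v - z)))"
      by (simp add: E_def D_def g_def image_iff split_paired_Ex)
    then show ?thesis
      unfolding R_def by blast
  qed
  have coneR: "r *\<^sub>R z \<in> R" if "z \<in> R" "r \<ge> 0" for r z
    using that \<P>(2) by (auto simp: R_def cone_def)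
  have "E \<noteq> {}"
    using \<open>R \<noteq> {}\<close> memE by blast
  then obtain e where e: "e \<in> E" "\<And>e'. e' \<in> E \<Longrightarrow> dist (-q0, - S q) e \<le> dist (-q0, - S q) e'"
    using distance_attains_inf[OF \<open>closed E\<close>] by blast
  then obtain v s z where vsz: "0 \<le> s" "z \<in> R" "e = (c \<bullet> v + s, S (A v - z))"
    using memE by blast
  define lam0 w where "lam0 = c \<bullet> v + q0 + s" and "w = S (A v + q - z)"
  define p where "p = (lam0, w)"
  have p: "p = e + (q0, S q)"
    by (simp add: p_def lam0_def w_def vsz(3) S.add S.diff)
  have p_le: "norm p \<le> norm (e' + (q0, S q))" if "e' \<in> E" for e'
  proof -
    have "dist (-q0, - S q) x = norm (x + (q0, S q))" for x
    proof -
      have "(-q0, - S q) - x = - (x + (q0, S q))"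
        by (simp add: prod_eq_iff)
      then show ?thesis
        by (simp only: dist_norm norm_minus_cancel)
    qed
    then show ?thesis
      using e(2)[OF that] p by simp
  qed
  have dir: "p \<bullet> d \<ge> 0" if "\<And>\<epsilon>. 0 < \<epsilon> \<Longrightarrow> \<epsilon> < 1 \<Longrightarrow> e + \<epsilon> *\<^sub>R d \<in> E" for d
  proof (rule inner_nonneg_of_norm_minimal)
    fix \<epsilon> :: real assume "0 < \<epsilon>" "\<epsilon> < 1"
    then show "norm p \<le> norm (p + \<epsilon> *\<^sub>R d)"
      using p_le[OF that[of \<epsilon>]] by (simp add: p algebra_simps)
  qed
  have "p \<bullet> (1, 0) \<ge> 0"
  proof (rule dir)
    fix \<epsilon> :: real assume "0 < \<epsilon>"
    then have "0 \<le> s + \<epsilon>" "e + \<epsilon> *\<^sub>R (1, 0) = (c \<bullet> v + (s + \<epsilon>), S (A v - z))"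
      using vsz by auto
    then show "e + \<epsilon> *\<^sub>R (1, 0) \<in> E"
      using vsz(2) memE by blast
  qed
  then have lam0: "lam0 \<ge> 0"
    by (simp add: p_def)
  have stat: "p \<bullet> (c \<bullet> h, S (A h)) \<ge> 0" for h
  proof (rule dir)
    fix \<epsilon> :: real assume "0 < \<epsilon>" "\<epsilon> < 1"
    have "e + \<epsilon> *\<^sub>R (c \<bullet> h, S (A h)) = (c \<bullet> (v + \<epsilon> *\<^sub>R h) + s, S (A (v + \<epsilon> *\<^sub>R h) - z))"
      by (simp add: vsz(3) inner_add_right A.add A.scale S.add S.diff S.scale)
    then show "e + \<epsilon> *\<^sub>R (c \<bullet> h, S (A h)) \<in> E"
      using vsz memE by blast
  qed
  have stationary: "lam0 * (c \<bullet> h) + w \<bullet> S (A h) = 0" for h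
    using stat[of h] stat[of "-h"] by (simp add: p_def A.neg S.neg)
  have scale: "r *\<^sub>R e \<in> E" if "r \<ge> 0" for r
  proof -
    have "r *\<^sub>R e = (c \<bullet> (r *\<^sub>R v) + r * s, S (A (r *\<^sub>R v) - r *\<^sub>R z))"
      by (simp add: vsz(3) algebra_simps A.scale S.scale flip: S.scale scaleR_diff_right)
    then show ?thesis
      using that vsz coneR memE by (metis mult_nonneg_nonneg)
  qed
  \<comment> \<open>Since \<open>E\<close> is a cone, \<open>e\<close> may be stretched and shrunk,
    so \<open>p\<close> is orthogonal to \<open>e\<close>. With \<open>p = e + (q0, S q)\<close> the
    second-order term becomes the squared norm of \<open>p\<close>.\<close>
  have "p \<bullet> e \<ge> 0"
  proof (rule dir)
    show "e + \<epsilon> *\<^sub>R e \<in> E" if "0 < \<epsilon>" for \<epsilon>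
      using scale[of "1 + \<epsilon>"] that by (simp add: scaleR_left_distrib)
  qed
  moreover have "p \<bullet> (-e) \<ge> 0"
  proof (rule dir)
    show "e + \<epsilon> *\<^sub>R (-e) \<in> E" if "\<epsilon> < 1" for \<epsilon>
      using scale[of "1 - \<epsilon>"] that by (simp add: scaleR_left_diff_distrib)
  qed
  ultimately have "p \<bullet> e = 0"
    by simp
  then have "p \<bullet> (q0, S q) = p \<bullet> p"
    by (metis add_0 inner_add_right p)
  \<comment> \<open>A vanishing residual would, by injectivity of \<open>S\<close>, produce a
    \<open>v\<close> with \<open>A v + q \<in> R\<close> and
    \<open>c \<bullet> v + q0 \<le> 0\<close>, contrary to \<open>infeasible\<close>.\<close>
  moreover have "p \<noteq> 0"
  proof
    assume "p = 0"
    then have "c \<bullet> v + q0 \<le> 0" "S (A v + q - z) = 0"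
      using vsz(1) by (auto simp: p_def lam0_def w_def zero_prod_def)
    then have "A v + q = z"
      using S(2) S.zero by (metis eq_iff_diff_eq_0 injD)
    then show False
      using spec[OF infeasible, of v] vsz(2) \<open>c \<bullet> v + q0 \<le> 0\<close> by simp
  qed
  ultimately have "p \<bullet> (q0, S q) > 0"
    by simp
  then have pos: "lam0 * q0 + w \<bullet> S q > 0"
    by (simp add: p_def)
  have "(norm p)\<^sup>2 = lam0\<^sup>2 + (norm w)\<^sup>2"
    by (simp add: p_def norm_Pair)
  then have minimal: "lam0\<^sup>2 + (norm w)\<^sup>2 \<le> (c \<bullet> v' + q0 + s')\<^sup>2 + (norm (S (A v' + q - z')))\<^sup>2"
    if "z' \<in> R" "s' \<ge> 0" for v' s' z'
  proof -
    have "(norm p)\<^sup>2 \<le> (norm ((c \<bullet> v' + s', S (A v' - z')) + (q0, S q)))\<^sup>2"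
      using that memE by (intro power_mono p_le norm_ge_zero) blast
    also have "\<dots> = (c \<bullet> v' + q0 + s')\<^sup>2 + (norm (S (A v' + q - z')))\<^sup>2"
      by (simp add: norm_Pair S.add S.diff algebra_simps)
    finally show ?thesis
      by (simp add: p_def norm_Pair)
  qed
  \<comment> \<open>For given \<open>v'\<close> this is the slack that makes the first component as
    small as possible in absolute value.\<close>
  have "lam0\<^sup>2 + (norm w)\<^sup>2 \<le> (max 0 (c \<bullet> v' + q0))\<^sup>2 + (norm (S (A v' + q - z')))\<^sup>2"
    if "z' \<in> R" for v' z'
    using minimal[OF that, of "max 0 (c \<bullet> v' + q0) - (c \<bullet> v' + q0)" v'] by simp
  \<comment> \<open>Keep \<open>v\<close> and \<open>s\<close> and replace only \<open>z\<close> by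
    \<open>y\<close>; expanding the square gives the proximal inequality.\<close>
  moreover have "w \<bullet> S (y - z) \<le> (norm (S (y - z)))\<^sup>2 / 2" if "y \<in> R" for y
  proof -
    have "S (A v + q - y) = w - S (y - z)"
      by (simp add: w_def S.add S.diff)
    then have "(norm w)\<^sup>2 \<le> (norm (w - S (y - z)))\<^sup>2"
      using minimal[OF that vsz(1), of v] by (simp add: lam0_def)
    then show ?thesis
      by (simp add: power2_norm_eq_inner inner_diff_left inner_diff_right inner_commute)
  qed
  moreover have "c \<bullet> v + q0 \<le> lam0"
    using vsz(1) by (simp add: lam0_def)
  ultimately show ?thesis
    using that[OF vsz(2) w_def lam0] stationary pos by blast
qed

section \<open>Coordinate blocks and the multiplier for a split constraint\<close>

lemma linear_block: "linear (block I)"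
  by (auto intro!: linearI simp: block_def vec_eq_iff)

lemmas block_add = linear_add[OF linear_block]
  and block_diff = linear_diff[OF linear_block]
  and block_scaleR = linear_scale[OF linear_block]

lemma block_block [simp]: "block I (block J y) = block (I \<inter> J) y"
  by (auto simp: block_def vec_eq_iff)

lemma block_empty [simp]: "block {} y = 0"
  by (auto simp: block_def vec_eq_iff)

lemma block_add_block_Compl: "block I y + block (- I) y = y"
  by (auto simp: block_def vec_eq_iff)

lemma inner_block: "block I x \<bullet> y = x \<bullet> block I y"
  by (auto simp: block_def inner_vec_def intro!: sum.cong)

lemma norm_block_le: "norm (block I y) \<le> norm y"
proof -
  have "block I y \<bullet> block I y \<le> y \<bullet> y"
    unfolding inner_vec_def by (intro sum_mono) (auto simp: block_def)
  then show ?thesis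
    by (simp add: norm_le)
qed

text \<open>
  The weight \<open>s\<close> on the second block penalizes its violation. Once \<open>s\<^sup>2\<close> exceeds the squared
  error bound constant, a projection with vanishing first part could be improved by moving to a
  point that is exactly feasible for the second block.
\<close>

lemma split_multiplier:
  fixes A :: "'a::euclidean_space \<Rightarrow> real^'m" and I :: "'m set"
    and c :: 'a and q0 :: real and q :: "real^'m" and \<P> :: "(real^'m) set set"
  defines "R \<equiv> \<Union>\<P>"
  assumes A: "linear A"
    and \<P>: "finite \<P>" "\<forall>P\<in>\<P>. polyhedron P \<and> cone P" and "R \<noteq> {}"
    and infeasible: "\<forall>v. A v + q \<in> R \<longrightarrow> c \<bullet> v + q0 > 0"
    and error_bound: "\<forall>v. \<forall>z\<in>R. \<exists>v' z'. z' \<in> R \<and> block I z' = block I z \<and>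
          block (- I) z' = block (- I) (A v' + q) \<and>
          norm (v' - v) \<le> \<kappa> * norm (block (- I) (A v + q - z))"
  obtains z lam0 lam M where "z \<in> R" "lam0 \<ge> 0" "\<forall>h. lam0 * (c \<bullet> h) + lam \<bullet> A h = 0"
    "lam0 * q0 + lam \<bullet> q > 0" "lam0 + norm (block I lam) \<noteq> 0"
    "\<forall>y\<in>R. lam \<bullet> (y - z) \<le> M * (norm (y - z))\<^sup>2"
    "c = 0 \<Longrightarrow> q0 = 0 \<Longrightarrow> lam0 = 0"
proof -
  obtain L where L: "L > 0" "\<And>h. norm (A h) \<le> L * norm h"
    using linear_bounded_pos[OF A] by blast
  \<comment> \<open>The first summand bounds the squared cost, in objective and first block, of
    repairing the second block; the extra 1 makes the final comparison strict unless
    \<open>d = 0\<close>.\<close>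
  define k where "k = ((norm c)\<^sup>2 + L\<^sup>2) * \<kappa>\<^sup>2 + 1"
  have k: "k > 0"
    by (simp add: k_def add_nonneg_pos)
  define s where "s = sqrt k"
  have s: "s > 0" "s\<^sup>2 = k"
    using k by (auto simp: s_def)
  define S :: "real^'m \<Rightarrow> real^'m" where "S y = block I y + s *\<^sub>R block (- I) y" for y
  have S: "linear S"
    by (auto intro!: linearI simp: S_def block_add block_scaleR algebra_simps)
  have self_adjoint: "S x \<bullet> y = x \<bullet> S y" for x y
    by (simp add: S_def inner_add_left inner_add_right inner_block)
  have blocks_S: "block I (S y) = block I y" "block (- I) (S y) = s *\<^sub>R block (- I) y" for y
    by (auto simp: S_def block_add block_scaleR)
  have "inj S"
  proof (rule injI)
    fix x y assume "S x = S y"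
    then have "block I x = block I y" "s *\<^sub>R block (- I) x = s *\<^sub>R block (- I) y"
      by (metis blocks_S)+
    then show "x = y"
      using s(1) block_add_block_Compl by (metis less_irrefl scaleR_cancel_left)
  qed
  obtain v z lam0 w where *: "z \<in> R" "w = S (A v + q - z)" "lam0 \<ge> 0" "c \<bullet> v + q0 \<le> lam0"
    "\<forall>h. lam0 * (c \<bullet> h) + w \<bullet> S (A h) = 0"
    "lam0 * q0 + w \<bullet> S q > 0"
    "\<forall>y\<in>R. w \<bullet> S (y - z) \<le> (norm (S (y - z)))\<^sup>2 / 2"
    "\<forall>v'. \<forall>z'\<in>R.
       lam0\<^sup>2 + (norm w)\<^sup>2 \<le> (max 0 (c \<bullet> v' + q0))\<^sup>2 + (norm (S (A v' + q - z')))\<^sup>2"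
    using projection_multiplier[OF A S \<open>inj S\<close> \<P> assms(5)[unfolded R_def] infeasible[unfolded R_def]]
    unfolding R_def by metis
  have nonzero: "lam0 + norm (block I (S w)) \<noteq> 0"
  \<comment> \<open>If both parts vanish, the residual is the weighted violation of the second block
    alone, with squared norm \<open>k * d\<^sup>2\<close>. The competitor from
    \<open>error_bound\<close> costs at most \<open>(k - 1) * d\<^sup>2\<close>, which forces
    \<open>d = 0\<close> and then contradicts the positive second-order term.\<close>
  proof
    assume "lam0 + norm (block I (S w)) = 0"
    then have zero: "lam0 = 0" "block I w = 0"
      using *(3) by (auto simp: blocks_S add_nonneg_eq_0_iff)
    define d where "d = norm (block (- I) (A v + q - z))"
    have w: "w = s *\<^sub>R block (- I) (A v + q - z)"
      using zero(2) block_add_block_Compl[of I w] by (simp add: *(2) blocks_S)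
    have "block I (A v + q - z) = 0"
      using zero(2) by (simp add: *(2) blocks_S)
    obtain v' z' where v': "z' \<in> R" "block I z' = block I z"
      "block (- I) z' = block (- I) (A v' + q)" "norm (v' - v) \<le> \<kappa> * d"
      using bspec[OF spec[OF error_bound, of v] *(1)] unfolding d_def by blast
    have "c \<bullet> v' + q0 = (c \<bullet> v + q0) + c \<bullet> (v' - v)"
      by (simp add: inner_diff_right)
    also have "\<dots> \<le> 0 + norm c * norm (v' - v)"
      using *(4) zero(1) norm_cauchy_schwarz by (intro add_mono) auto
    also have "\<dots> \<le> norm c * (\<kappa> * d)"
      using v'(4) by (simp add: mult_left_mono)
    finally have "max 0 (c \<bullet> v' + q0) \<le> norm c * (\<kappa> * d)"
      using norm_ge_zero v'(4) by (meson max.boundedI mult_nonneg_nonneg order_trans)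
    then have 1: "(max 0 (c \<bullet> v' + q0))\<^sup>2 \<le> (norm c)\<^sup>2 * \<kappa>\<^sup>2 * d\<^sup>2"
      by (metis max.cobounded1 mult.assoc power_mono power_mult_distrib)
    have "block I (A v' + q - z') = block I (A (v' - v))"
      using v'(2) \<open>block I (A v + q - z) = 0\<close>
      by (simp add: block_diff block_add linear_diff[OF A] algebra_simps)
    then have "S (A v' + q - z') = block I (A (v' - v))"
      using v'(3) by (simp add: S_def block_diff)
    then have "norm (S (A v' + q - z')) \<le> norm (A (v' - v))"
      by (simp add: norm_block_le)
    also have "\<dots> \<le> L * (\<kappa> * d)"
      using L v'(4) by (meson less_imp_le mult_left_mono order_trans)
    finally have 2: "(norm (S (A v' + q - z')))\<^sup>2 \<le> L\<^sup>2 * \<kappa>\<^sup>2 * d\<^sup>2"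
      by (metis mult.assoc norm_ge_zero power_mono power_mult_distrib)
    have "(norm w)\<^sup>2 = k * d\<^sup>2"
      using s by (simp add: w d_def power_mult_distrib)
    then have "k * d\<^sup>2 \<le> (norm c)\<^sup>2 * \<kappa>\<^sup>2 * d\<^sup>2 + L\<^sup>2 * \<kappa>\<^sup>2 * d\<^sup>2"
      using bspec[OF spec[OF *(8), of v'] v'(1)] 1 2 zero(1) by simp
    then have "d = 0"
      by (simp add: k_def algebra_simps)
    then have "w = 0"
      by (simp add: w d_def)
    then show False
      using *(6) zero(1) by simp
  qed
  obtain B where B: "B > 0" "\<And>h. norm (S h) \<le> B * norm h"
    using linear_bounded_pos[OF S] by blast
  have "S w \<bullet> (y - z) \<le> B\<^sup>2 / 2 * (norm (y - z))\<^sup>2" if "y \<in> R" for y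
  proof -
    have "(norm (S (y - z)))\<^sup>2 \<le> (B * norm (y - z))\<^sup>2"
      using B(2) by (intro power_mono) auto
    then show ?thesis
      using bspec[OF *(7) that] by (simp add: self_adjoint power_mult_distrib)
  qed
  \<comment> \<open>Compare the minimizer with itself: without an objective the first term on the
    right of the minimality inequality is zero, and the second equals the squared norm of
    \<open>w\<close>.\<close>
  moreover have "lam0 = 0" if "c = 0" "q0 = 0"
    using bspec[OF spec[OF *(8), of v] *(1)] that by (simp flip: *(2))
  ultimately show ?thesis
    using that[OF *(1,3) _ _ nonzero, of "B\<^sup>2 / 2"] *(5,6) by (simp add: self_adjoint)
qed

subsection \<open>Second-order expansions\<close>

text \<open>Taylor's formula from differentiability of \<open>g'\<close> at the single point
  \<open>x\<close>. The mean value inequality is applied along the segment to \<open>g\<close> minus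
  its quadratic model, whose derivative is controlled by the first-order expansion of
  \<open>g'\<close>.\<close>

lemma second_order_expansion:
  fixes g :: "'a::real_normed_vector \<Rightarrow> 'b::real_normed_vector" and g' :: "'a \<Rightarrow> 'a \<Rightarrow>\<^sub>L 'b"
  assumes g': "\<forall>\<^sub>F y in nhds x. (g has_derivative blinfun_apply (g' y)) (at y)"
    and g'': "(g' has_derivative g'') (at x)" and "e > 0"
  shows "\<exists>d>0. \<forall>h. norm h < d \<longrightarrow>
    norm (g (x + h) - g x - g' x h - (1/2) *\<^sub>R g'' h h) \<le> e * (norm h)\<^sup>2"
proof -
  obtain d1 where d1: "d1 > 0" "\<And>y. dist y x < d1 \<Longrightarrow> (g has_derivative blinfun_apply (g' y)) (at y)"
    using g' unfolding eventually_nhds_metric by blast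
  obtain d2 where d2: "d2 > 0"
    "\<And>y. norm (y - x) < d2 \<Longrightarrow> norm (g' y - g' x - g'' (y - x)) \<le> e * norm (y - x)"
    using g'' \<open>e > 0\<close> unfolding has_derivative_at_alt by metis
  interpret g'': bounded_linear g''
    by (rule has_derivative_bounded_linear[OF g''])
  have "norm (g (x + h) - g x - g' x h - (1/2) *\<^sub>R g'' h h) \<le> e * (norm h)\<^sup>2"
    if h: "norm h < min d1 d2" for h
  proof -
    define \<psi> where "\<psi> s = g (x + s *\<^sub>R h) - s *\<^sub>R g' x h - (s\<^sup>2 / 2) *\<^sub>R g'' h h" for s
    define \<psi>' where "\<psi>' s = g' (x + s *\<^sub>R h) h - g' x h - s *\<^sub>R g'' h h" for s
    have small: "norm (s *\<^sub>R h) < d1" "norm (s *\<^sub>R h) < d2" "norm (s *\<^sub>R h) \<le> norm h"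
      if "s \<in> {0..1}" for s
    proof -
      have "norm (s *\<^sub>R h) \<le> norm h"
        using that by (simp add: mult_left_le_one_le)
      then show "norm (s *\<^sub>R h) < d1" "norm (s *\<^sub>R h) < d2" "norm (s *\<^sub>R h) \<le> norm h"
        using h by linarith+
    qed
    have "norm (\<psi> 1 - \<psi> 0 - (1 - 0) *\<^sub>R \<psi>' 0) \<le> norm (1 - 0 :: real) * (e * (norm h)\<^sup>2)"
    proof (rule vector_differentiable_bound_linearization)
      fix s :: real assume s: "s \<in> {0..1}"
      have "((\<lambda>s. g (x + s *\<^sub>R h)) has_derivative (\<lambda>r. g' (x + s *\<^sub>R h) (r *\<^sub>R h))) (at s)"
      proof (rule has_derivative_compose[where g = g])
        show "((\<lambda>s. x + s *\<^sub>R h) has_derivative (\<lambda>r. r *\<^sub>R h)) (at s)"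
          by (auto intro!: derivative_eq_intros)
        show "(g has_derivative blinfun_apply (g' (x + s *\<^sub>R h))) (at (x + s *\<^sub>R h))"
          using small[OF s] by (intro d1) (simp add: dist_norm)
      qed
      then have "((\<lambda>s. g (x + s *\<^sub>R h)) has_vector_derivative g' (x + s *\<^sub>R h) h) (at s)"
        by (simp add: has_vector_derivative_def blinfun.scaleR_right)
      then have "(\<psi> has_vector_derivative \<psi>' s) (at s)"
        unfolding \<psi>_def \<psi>'_def by (auto intro!: derivative_eq_intros)
      then show "(\<psi> has_vector_derivative \<psi>' s) (at s within {0..1})"
        by (rule has_vector_derivative_at_within)
      have "\<psi>' s - \<psi>' 0 = (g' (x + s *\<^sub>R h) - g' x - g'' (s *\<^sub>R h)) h"
        by (simp add: \<psi>'_def blinfun.diff_left g''.scaleR blinfun.scaleR_left)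
      then have "norm (\<psi>' s - \<psi>' 0) \<le> norm (g' (x + s *\<^sub>R h) - g' x - g'' (s *\<^sub>R h)) * norm h"
        by (simp add: norm_blinfun)
      also have "\<dots> \<le> e * norm (s *\<^sub>R h) * norm h"
        using d2(2)[of "x + s *\<^sub>R h"] small[OF s] by (intro mult_right_mono) auto
      also have "\<dots> \<le> e * norm h * norm h"
        using small[OF s] \<open>e > 0\<close> by (intro mult_right_mono mult_left_mono) auto
      finally show "norm (\<psi>' s - \<psi>' 0) \<le> e * (norm h)\<^sup>2"
        by (simp add: power2_eq_square)
    qed (auto simp: closed_segment_eq_real_ivl)
    then show ?thesis
      by (simp add: \<psi>_def \<psi>'_def algebra_simps)
  qed
  then show ?thesis
    using d1(1) d2(1) by (intro exI[of _ "min d1 d2"]) auto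
qed

text \<open>The directions \<open>h k\<close> may vary with \<open>k\<close>, so this covers both
  the arcs with \<open>h k = u + t k v\<close> and the normalized sequences used for
  sufficiency.\<close>

lemma second_order_limit:
  fixes g :: "'a::real_normed_vector \<Rightarrow> 'b::real_normed_vector" and g' :: "'a \<Rightarrow> 'a \<Rightarrow>\<^sub>L 'b"
  assumes g': "\<forall>\<^sub>F y in nhds x. (g has_derivative blinfun_apply (g' y)) (at y)"
    and g'': "(g' has_derivative g'') (at x)"
    and t: "(t \<longlongrightarrow> 0) F" "\<forall>\<^sub>F k in F. t k > 0" and h: "(h \<longlongrightarrow> u) F"
  shows "((\<lambda>k. (g (x + t k *\<^sub>R h k) - g x - t k *\<^sub>R g' x (h k)) /\<^sub>R (t k)\<^sup>2)
           \<longlongrightarrow> (1/2) *\<^sub>R g'' u u) F"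
proof -
  define r where "r h = g (x + h) - g x - g' x h - (1/2) *\<^sub>R g'' h h" for h
  interpret g'': bounded_linear g''
    by (rule has_derivative_bounded_linear[OF g''])
  have "((\<lambda>k. r (t k *\<^sub>R h k) /\<^sub>R (t k)\<^sup>2) \<longlongrightarrow> 0) F"
  proof (rule tendstoI)
    fix e :: real assume "e > 0"
    \<comment> \<open>Eventually \<open>norm (h k) < norm u + 1\<close>, so the remainder divided by
      \<open>(t k)\<^sup>2\<close> is at most \<open>e / 2\<close>.\<close>
    define e' where "e' = e / (2 * (norm u + 1)\<^sup>2)"
    have u1: "0 < norm u + 1"
      by (simp add: add_nonneg_pos)
    then have e': "e' > 0"
      using \<open>e > 0\<close> by (simp add: e'_def)
    obtain d where d: "d > 0" "\<And>h. norm h < d \<Longrightarrow> norm (r h) \<le> e' * (norm h)\<^sup>2"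
      using second_order_expansion[OF g' g'' e'] unfolding r_def by blast
    have "((\<lambda>k. norm (t k *\<^sub>R h k)) \<longlongrightarrow> norm (0 *\<^sub>R u)) F"
      by (intro tendsto_intros t h)
    then have "\<forall>\<^sub>F k in F. norm (t k *\<^sub>R h k) < d"
      using d(1) by (intro order_tendstoD) auto
    moreover have "\<forall>\<^sub>F k in F. norm (h k) < norm u + 1"
      using tendsto_norm[OF h] by (rule order_tendstoD) simp
    ultimately show "\<forall>\<^sub>F k in F. dist (r (t k *\<^sub>R h k) /\<^sub>R (t k)\<^sup>2) 0 < e"
      using t(2)
    proof eventually_elim
      case (elim k)
      have "norm (r (t k *\<^sub>R h k)) \<le> e' * (t k * norm (h k))\<^sup>2"
        using d(2)[OF elim(1)] elim(3) by simp
      then have "norm (r (t k *\<^sub>R h k)) / (t k)\<^sup>2 \<le> e' * (norm (h k))\<^sup>2"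
        using elim(3) by (simp add: divide_le_eq power_mult_distrib mult_ac)
      also have "\<dots> \<le> e' * (norm u + 1)\<^sup>2"
        using e' elim(2) by (intro mult_left_mono power_mono) auto
      also have "\<dots> = e / 2"
        using u1 by (simp add: e'_def)
      also have "\<dots> < e"
        using \<open>e > 0\<close> by simp
      finally show ?case
        by (simp add: divide_inverse mult.commute)
    qed
  qed
  moreover have "((\<lambda>k. (1/2) *\<^sub>R g'' (h k) (h k)) \<longlongrightarrow> (1/2) *\<^sub>R g'' u u) F"
    by (intro tendsto_intros g''.tendsto h)
  ultimately have "((\<lambda>k. r (t k *\<^sub>R h k) /\<^sub>R (t k)\<^sup>2 + (1/2) *\<^sub>R g'' (h k) (h k))
      \<longlongrightarrow> 0 + (1/2) *\<^sub>R g'' u u) F"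
    by (rule tendsto_add)
  moreover have "\<forall>\<^sub>F k in F. r (t k *\<^sub>R h k) /\<^sub>R (t k)\<^sup>2 + (1/2) *\<^sub>R g'' (h k) (h k) =
      (g (x + t k *\<^sub>R h k) - g x - t k *\<^sub>R g' x (h k)) /\<^sub>R (t k)\<^sup>2"
    using t(2)
  proof eventually_elim
    case (elim k)
    then show ?case
      by (simp add: r_def g''.scaleR blinfun.scaleR_left blinfun.scaleR_right scaleR_diff_right
          power2_eq_square) (simp add: field_simps)
  qed
  ultimately show ?thesis
    by (simp add: filterlim_cong)
qed

section \<open>Gradients, Jacobians and Hessians in terms of bounded linear derivatives\<close>

lemma gradient_inner:
  assumes "(g has_derivative D) (at x)"
  shows "gradient g x \<bullet> h = D h"
proof -
  have D: "D = frechet_derivative g (at x)"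
    by (rule frechet_derivative_at[OF assms])
  have "linear D"
    using assms by (simp add: has_derivative_bounded_linear bounded_linear.linear)
  then have "D y = adjoint D 1 \<bullet> y" for y
    using adjoint_works[of D y 1] by (simp add: inner_commute)
  then have "gradient g x = adjoint D 1"
    by (simp add: gradient_def vec_eq_iff inner_axis flip: D)
  then show ?thesis
    using \<open>\<And>y. D y = adjoint D 1 \<bullet> y\<close> by simp
qed

lemma jacobian_vector_mult:
  fixes g :: "real^'n \<Rightarrow> real^'m"
  assumes "(g has_derivative D) (at x)"
  shows "jacobian g (at x) *v h = D h"
  using assms frechet_derivative_at[OF assms]
  by (simp add: jacobian_def matrix_works linear_matrix_vector_mul_eq
      has_derivative_bounded_linear bounded_linear.linear)

text \<open>Component \<open>i\<close> of the Hessian applied to \<open>u\<close> is the derivative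
  along \<open>u\<close> of the \<open>i\<close>-th partial derivative, that is
  \<open>g'' u (axis i 1)\<close>. Expanding \<open>u\<close> in the second argument gives the
  quadratic form.\<close>

lemma hessian_quadratic_form:
  fixes g :: "real^'n \<Rightarrow> real" and g' :: "real^'n \<Rightarrow> (real^'n) \<Rightarrow>\<^sub>L real"
  assumes g': "\<forall>\<^sub>F y in nhds x. (g has_derivative blinfun_apply (g' y)) (at y)"
    and g'': "(g' has_derivative g'') (at x)"
  shows "u \<bullet> (hessian g x *v u) = g'' u u"
proof -
  have grad: "\<forall>\<^sub>F y in nhds x. (\<chi> i. g' y (axis i 1)) = gradient g y"
    using g'
  proof eventually_elim
    case (elim y)
    then show ?case
      by (simp add: gradient_def flip: frechet_derivative_at[OF elim])
  qed
  have "((\<lambda>y. \<chi> i. g' y (axis i 1)) has_derivative (\<lambda>h. \<chi> i. g'' h (axis i 1))) (at x)"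
  proof (subst has_derivative_componentwise_within, rule ballI)
    fix b :: "real^'n" assume "b \<in> Basis"
    then obtain j where b: "b = axis j 1"
      by (auto simp: Basis_vec_def)
    have "((\<lambda>y. g' y (axis j 1)) has_derivative (\<lambda>h. g'' h (axis j 1))) (at x)"
      by (rule bounded_linear.has_derivative[OF blinfun.bounded_linear_left g''])
    then show "((\<lambda>y. (\<chi> i. g' y (axis i 1)) \<bullet> b) has_derivative (\<lambda>h. (\<chi> i. g'' h (axis i 1)) \<bullet> b)) (at x)"
      by (simp add: b inner_axis)
  qed
  \<comment> \<open>The coordinate vector of \<open>g'\<close> equals the gradient only near
    \<open>x\<close>, which suffices for the derivative at \<open>x\<close>.\<close>
  then have "(gradient g has_derivative (\<lambda>h. \<chi> i. g'' h (axis i 1))) (at x)"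
    using grad eventually_nhds_x_imp_x[OF grad]
    by (elim has_derivative_transform_eventually) (auto simp: eventually_at_filter elim: eventually_mono)
  then have "hessian g x *v u = (\<chi> i. g'' u (axis i 1))"
    unfolding hessian_def by (rule jacobian_vector_mult)
  moreover have "g'' u u = (\<Sum>i\<in>UNIV. u $ i * g'' u (axis i 1))"
  proof -
    have "g'' u u = g'' u (\<Sum>i\<in>UNIV. (u $ i) *\<^sub>R axis i 1)"
      using basis_expansion[of u] by (simp add: scalar_mult_eq_scaleR)
    then show ?thesis
      by (simp add: blinfun.sum_right blinfun.scaleR_right)
  qed
  ultimately show ?thesis
    by (simp add: inner_vec_def)
qed

lemma lagrangian_derivatives:
  fixes f :: "real^'n \<Rightarrow> real" and F :: "real^'n \<Rightarrow> real^'m"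
    and f' :: "real^'n \<Rightarrow> (real^'n) \<Rightarrow>\<^sub>L real" and F' :: "real^'n \<Rightarrow> (real^'n) \<Rightarrow>\<^sub>L (real^'m)"
  assumes f': "\<forall>\<^sub>F y in nhds x. (f has_derivative blinfun_apply (f' y)) (at y)"
    and f'': "(f' has_derivative f'') (at x)"
    and F': "\<forall>\<^sub>F y in nhds x. (F has_derivative blinfun_apply (F' y)) (at y)"
    and F'': "(F' has_derivative F'') (at x)"
  shows "gradient (\<lambda>x. lagrangian f F x lam0 lam) x \<bullet> h = lam0 * f' x h + lam \<bullet> F' x h"
    and "u \<bullet> (hessian (\<lambda>x. lagrangian f F x lam0 lam) x *v u) = lam0 * f'' u u + lam \<bullet> F'' u u"
proof -
  define L' where "L' y = lam0 *\<^sub>R f' y + (blinfun_inner_right lam o\<^sub>L F' y)" for y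
  define L'' where "L'' h = lam0 *\<^sub>R f'' h + (blinfun_inner_right lam o\<^sub>L F'' h)" for h
  have L': "\<forall>\<^sub>F y in nhds x. ((\<lambda>x. lagrangian f F x lam0 lam) has_derivative blinfun_apply (L' y)) (at y)"
    using f' F'
  proof eventually_elim
    case (elim y)
    show ?case
      unfolding lagrangian_def L'_def
      by (rule has_derivative_eq_rhs[OF has_derivative_add[OF
              has_derivative_mult_right[OF elim(1)] has_derivative_inner_right[OF elim(2)]]])
        (simp add: fun_eq_iff blinfun.add_left blinfun.scaleR_left)
  qed
  have L'': "(L' has_derivative L'') (at x)"
    unfolding L'_def L''_def
    by (intro has_derivative_add has_derivative_scaleR_right f''
        bounded_linear.has_derivative[OF bounded_bilinear.bounded_linear_right[OF bounded_bilinear_blinfun_compose]] F'')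
  show "gradient (\<lambda>x. lagrangian f F x lam0 lam) x \<bullet> h = lam0 * f' x h + lam \<bullet> F' x h"
    using gradient_inner[OF eventually_nhds_x_imp_x[OF L']]
    by (simp add: L'_def blinfun.add_left blinfun.scaleR_left)
  show "u \<bullet> (hessian (\<lambda>x. lagrangian f F x lam0 lam) x *v u) = lam0 * f'' u u + lam \<bullet> F'' u u"
    using hessian_quadratic_form[OF L' L'']
    by (simp add: L''_def blinfun.add_left blinfun.scaleR_left)
qed

subsection \<open>Sufficient condition\<close>

text \<open>The normal quotient is constant along segments running into \<open>z\<close>, and local
  conicity keeps these segments in \<open>C\<close>. The limsup bound, which holds only
  asymptotically, therefore becomes an exact inequality on a ball.\<close>

lemma frechet_normal_cone_locally_conic:
  assumes "locally_conic z C" "\<xi> \<in> frechet_normal_cone z C"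
  obtains r where "r > 0" "\<And>h. norm h < r \<Longrightarrow> z + h \<in> C \<Longrightarrow> \<xi> \<bullet> h \<le> 0"
proof -
  obtain r where r: "r > 0"
    "\<And>w t. norm w < r \<Longrightarrow> 0 < t \<Longrightarrow> t \<le> 1 \<Longrightarrow> z + w \<in> C \<longleftrightarrow> z + t *\<^sub>R w \<in> C"
    using assms(1) unfolding locally_conic_def by blast
  have limsup: "Limsup (at z within C) (\<lambda>z'. ereal (\<xi> \<bullet> (z' - z) / norm (z' - z))) \<le> 0"
    using assms(2) by (auto simp: frechet_normal_cone_def split: if_splits)
  have "\<xi> \<bullet> h \<le> 0" if h: "norm h < r" "z + h \<in> C" for h
  proof (cases "h = 0")
    case False
    have "\<xi> \<bullet> h / norm h \<le> 0 + e" if "e > 0" for e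
    proof -
      have "\<forall>\<^sub>F z' in at z within C. ereal (\<xi> \<bullet> (z' - z) / norm (z' - z)) < ereal e"
        using limsup that unfolding Limsup_le_iff by (metis ereal_less(2))
      then obtain d where d: "d > 0" "\<And>z'. z' \<in> C \<Longrightarrow> z' \<noteq> z \<Longrightarrow> dist z' z < d \<Longrightarrow>
          \<xi> \<bullet> (z' - z) / norm (z' - z) < e"
        unfolding eventually_at by auto
      \<comment> \<open>Scaling by \<open>t\<close> moves \<open>z + h\<close> to within distance
        \<open>d\<close> of \<open>z\<close> without changing the quotient.\<close>
      define t where "t = min 1 (d / (2 * norm h))"
      have t: "0 < t" "t \<le> 1" "t * norm h < d"
        using d(1) False by (auto simp: t_def min_def field_simps)
      have "\<xi> \<bullet> (t *\<^sub>R h) / norm (t *\<^sub>R h) < e"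
        using d(2)[of "z + t *\<^sub>R h"] r(2)[OF h(1) t(1,2)] h(2) t False by (simp add: dist_norm)
      then show ?thesis
        using t(1) by simp
    qed
    then have "\<xi> \<bullet> h / norm h \<le> 0"
      by (rule field_le_epsilon)
    then show ?thesis
      using False by (simp add: divide_le_0_iff)
  qed simp
  then show ?thesis
    using that r(1) by blast
qed

text \<open>Refuting growth with neighborhood radius and constant both equal to \<open>e n\<close>
  gives points \<open>x n\<close>. Their normalized displacements lie on the compact unit sphere,
  and a convergent subsequence provides \<open>u\<close>.\<close>

lemma not_essential_sequence:
  fixes f :: "real^'n \<Rightarrow> real" and F :: "real^'n \<Rightarrow> real^'m"
  assumes "F xbar \<in> \<Omega>" "\<not> essential_local_minimizer_second_order f F \<Omega> xbar"
  obtains t h \<epsilon> u where "\<And>k::nat. t k > 0" "t \<longlonglongrightarrow> 0" "h \<longlonglongrightarrow> u" "u \<noteq> 0" "\<epsilon> \<longlonglongrightarrow> 0"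
    "\<And>k. f (xbar + t k *\<^sub>R h k) - f xbar \<le> \<epsilon> k * (t k)\<^sup>2"
    "\<And>k. infdist (F (xbar + t k *\<^sub>R h k)) \<Omega> \<le> \<epsilon> k * (t k)\<^sup>2"
proof -
  define e where "e n = inverse (real (Suc n))" for n
  have e: "e \<longlonglongrightarrow> 0" "\<And>n. e n > 0"
    unfolding e_def using LIMSEQ_inverse_real_of_nat by auto
  have "\<exists>x. dist xbar x < e n \<and> max (f x - f xbar) (infdist (F x) \<Omega>) < e n * (norm (x - xbar))\<^sup>2" for n
  proof (rule ccontr)
    assume "\<not> ?thesis"
    then have "\<forall>x\<in>ball xbar (e n). max (f x - f xbar) (infdist (F x) \<Omega>) \<ge> e n * (norm (x - xbar))\<^sup>2"
      by (force simp: not_less not_le le_max_iff_disj)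
    then show False
      using assms e(2)[of n] unfolding essential_local_minimizer_second_order_def
      by (metis centre_in_ball open_ball)
  qed
  then obtain x where x: "\<And>n. dist xbar (x n) < e n"
    "\<And>n. max (f (x n) - f xbar) (infdist (F (x n)) \<Omega>) < e n * (norm (x n - xbar))\<^sup>2"
    by metis
  define s where "s n = norm (x n - xbar)" for n
  define d where "d n = (x n - xbar) /\<^sub>R s n" for n
  have s: "s n > 0" for n
  proof -
    \<comment> \<open>At \<open>xbar\<close> both sides of the strict inequality would be zero,
      since \<open>xbar\<close> is feasible.\<close>
    have "x n \<noteq> xbar"
      using x(2)[of n] assms(1) by auto
    then show ?thesis
      by (simp add: s_def)
  qed
  have "norm (d n) = 1" for n
    using s[of n] by (simp add: d_def flip: s_def)
  then have "\<forall>n. d n \<in> sphere 0 1"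
    by simp
  then obtain u r where u: "u \<in> sphere 0 1" "strict_mono r" "(d \<circ> r) \<longlonglongrightarrow> u"
    using compact_sphere[of 0 1] unfolding compact_def by metis
  have "s \<longlonglongrightarrow> 0"
  proof (rule tendsto_sandwich[OF _ _ tendsto_const e(1)])
    show "\<forall>\<^sub>F n in sequentially. s n \<le> e n"
      using x(1) by (intro always_eventually allI less_imp_le) (simp add: s_def dist_norm norm_minus_commute)
  qed (simp add: s_def)
  have x_eq: "xbar + s n *\<^sub>R d n = x n" for n
    using s[of n] by (simp add: d_def)
  show ?thesis
  proof (rule that[of "s \<circ> r" "d \<circ> r" u "e \<circ> r"])
    show "(s \<circ> r) \<longlonglongrightarrow> 0" "(e \<circ> r) \<longlonglongrightarrow> 0"
      using LIMSEQ_subseq_LIMSEQ[OF _ u(2)] \<open>s \<longlonglongrightarrow> 0\<close> e(1) by auto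
    show "f (xbar + (s \<circ> r) k *\<^sub>R (d \<circ> r) k) - f xbar \<le> (e \<circ> r) k * ((s \<circ> r) k)\<^sup>2"
      and "infdist (F (xbar + (s \<circ> r) k *\<^sub>R (d \<circ> r) k)) \<Omega> \<le> (e \<circ> r) k * ((s \<circ> r) k)\<^sup>2" for k
      using x(2)[of "r k"] by (simp_all add: x_eq flip: s_def)
  qed (use s u in auto)
qed

lemma frechet_multipliers_sufficient:
  fixes f :: "real^'n \<Rightarrow> real" and F :: "real^'n \<Rightarrow> real^'m"
    and f' :: "real^'n \<Rightarrow> (real^'n) \<Rightarrow>\<^sub>L real" and F' :: "real^'n \<Rightarrow> (real^'n) \<Rightarrow>\<^sub>L (real^'m)"
  assumes f': "\<forall>\<^sub>F y in nhds xbar. (f has_derivative blinfun_apply (f' y)) (at y)"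
    and f'': "(f' has_derivative f'') (at xbar)"
    and F': "\<forall>\<^sub>F y in nhds xbar. (F has_derivative blinfun_apply (F' y)) (at y)"
    and F'': "(F' has_derivative F'') (at xbar)"
    and \<Omega>: "finite_union_polyhedra \<Omega>" "F xbar \<in> \<Omega>"
    and mult: "\<And>u. u \<in> critical_cone f F \<Omega> xbar \<Longrightarrow> u \<noteq> 0 \<Longrightarrow>
      \<exists>lam0\<ge>0. \<exists>lam\<in>frechet_multipliers f F \<Omega> (I u) lam0 xbar u.
        u \<bullet> (hessian (\<lambda>x. lagrangian f F x lam0 lam) xbar *v u) > 0"
  shows "essential_local_minimizer_second_order f F \<Omega> xbar"
proof (rule ccontr)
  assume "\<not> ?thesis"
  then obtain t h \<epsilon> u where t: "\<And>k::nat. t k > 0" "t \<longlonglongrightarrow> 0" and h: "h \<longlonglongrightarrow> u" "u \<noteq> 0"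
    and \<epsilon>: "\<epsilon> \<longlonglongrightarrow> 0" "\<And>k. f (xbar + t k *\<^sub>R h k) - f xbar \<le> \<epsilon> k * (t k)\<^sup>2"
      "\<And>k. infdist (F (xbar + t k *\<^sub>R h k)) \<Omega> \<le> \<epsilon> k * (t k)\<^sup>2"
    using not_essential_sequence[of F xbar \<Omega> f] \<Omega>(2) by metis
  define rf where "rf k = (f (xbar + t k *\<^sub>R h k) - f xbar - t k *\<^sub>R f' xbar (h k)) /\<^sub>R (t k)\<^sup>2" for k
  define rF where "rF k = (F (xbar + t k *\<^sub>R h k) - F xbar - t k *\<^sub>R F' xbar (h k)) /\<^sub>R (t k)\<^sup>2" for k
  have rf: "rf \<longlonglongrightarrow> (1/2) *\<^sub>R f'' u u"
    unfolding rf_def using t h(1) by (intro second_order_limit[OF f' f'']) auto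
  have rF: "rF \<longlonglongrightarrow> (1/2) *\<^sub>R F'' u u"
    unfolding rF_def using t h(1) by (intro second_order_limit[OF F' F'']) auto
  have f_eq: "f (xbar + t k *\<^sub>R h k) - f xbar = t k * f' xbar (h k) + (t k)\<^sup>2 * rf k" for k
    using t(1)[of k] by (simp add: rf_def field_simps)
  have F_eq: "F (xbar + t k *\<^sub>R h k) - F xbar = t k *\<^sub>R F' xbar (h k) + (t k)\<^sup>2 *\<^sub>R rF k" for k
    using t(1)[of k] by (simp add: rF_def)
  have \<epsilon>_nonneg: "\<epsilon> k \<ge> 0" for k
    using \<epsilon>(3)[of k] t(1)[of k] by (meson infdist_nonneg order_trans zero_le_mult_iff zero_less_power not_less)
  have "\<exists>y\<in>\<Omega>. dist (F (xbar + t k *\<^sub>R h k)) y \<le> \<epsilon> k * (t k)\<^sup>2" for k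
    using infdist_attains_inf[of \<Omega> "F (xbar + t k *\<^sub>R h k)"] \<Omega> finite_union_polyhedra_closed \<epsilon>(3)
    by (metis empty_iff)
  then obtain y where y: "\<And>k. y k \<in> \<Omega>" "\<And>k. norm (y k - F (xbar + t k *\<^sub>R h k)) \<le> \<epsilon> k * (t k)\<^sup>2"
    by (metis dist_commute dist_norm)
  define r where "r k = (y k - F (xbar + t k *\<^sub>R h k)) /\<^sub>R (t k)\<^sup>2" for k
  have r_le: "norm (r k) \<le> \<epsilon> k" for k
    using y(2)[of k] t(1)[of k] by (simp add: r_def divide_simps mult.commute)
  have r: "r \<longlonglongrightarrow> 0"
    by (rule Lim_null_comparison[OF _ \<epsilon>(1)]) (simp add: r_le)
  define w where "w = F' xbar u"
  \<comment> \<open>\<open>t k *\<^sub>R d k\<close> is the displacement from \<open>F xbar\<close>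
    to the nearest feasible value \<open>y k\<close>; the residual \<open>r k\<close> tends to 0
    because the distance to \<Omega> is o(t^2).\<close>
  define d where "d k = F' xbar (h k) + t k *\<^sub>R (rF k + r k)" for k
  have y_eq: "y k = F xbar + t k *\<^sub>R d k" for k
  proof -
    have "y k = F (xbar + t k *\<^sub>R h k) + (t k)\<^sup>2 *\<^sub>R r k"
      using t(1)[of k] by (simp add: r_def)
    also have "\<dots> = F xbar + (t k *\<^sub>R F' xbar (h k) + (t k)\<^sup>2 *\<^sub>R rF k) + (t k)\<^sup>2 *\<^sub>R r k"
      using F_eq[of k] by (metis add.commute diff_add_cancel)
    finally show ?thesis
      by (simp add: d_def power2_eq_square algebra_simps)
  qed
  have "d \<longlonglongrightarrow> F' xbar u + 0 *\<^sub>R ((1/2) *\<^sub>R F'' u u + 0)"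
    unfolding d_def by (intro tendsto_intros h t rF r)
  then have d: "d \<longlonglongrightarrow> w"
    by (simp add: w_def)
  define K where "K = radial_cone (F xbar) \<Omega>"
  have K: "contingent_cone (F xbar) \<Omega> = K"
    unfolding K_def by (rule contingent_cone_eq_radial_cone[OF \<Omega>])
  have jac: "jacobian F (at xbar) *v v = F' xbar v" for v
    by (rule jacobian_vector_mult[OF eventually_nhds_x_imp_x[OF F']])
  have grad: "gradient f xbar \<bullet> v = f' xbar v" for v
    by (rule gradient_inner[OF eventually_nhds_x_imp_x[OF f']])
  have "\<forall>k. F xbar + t k *\<^sub>R d k \<in> \<Omega>"
    using y(1) y_eq by metis
  then have "\<exists>ws t. ws \<longlonglongrightarrow> w \<and> (\<forall>k. 0 < t k) \<and> t \<longlonglongrightarrow> (0::real)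
      \<and> (\<forall>k::nat. F xbar + t k *\<^sub>R ws k \<in> \<Omega>)"
    using d t by blast
  then have "w \<in> contingent_cone (F xbar) \<Omega>"
    using \<Omega>(2) by (simp add: contingent_cone_def)
  then have "w \<in> K"
    by (simp add: K)
  moreover have "f' xbar u \<le> 0"
  proof (rule LIMSEQ_le)
    show "(\<lambda>k. f' xbar (h k)) \<longlonglongrightarrow> f' xbar u"
      by (intro tendsto_intros h)
    show "(\<lambda>k. t k * (\<epsilon> k - rf k)) \<longlonglongrightarrow> 0"
      by (rule tendsto_eq_rhs[OF tendsto_mult[OF t(2) tendsto_diff[OF \<epsilon>(1) rf]]]) simp
    have "f' xbar (h k) \<le> t k * (\<epsilon> k - rf k)" for k
    proof -
      have "t k * f' xbar (h k) + (t k)\<^sup>2 * rf k \<le> \<epsilon> k * (t k)\<^sup>2"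
        using \<epsilon>(2)[of k] by (simp add: f_eq)
      then have "t k * f' xbar (h k) \<le> t k * (t k * (\<epsilon> k - rf k))"
        by (simp add: power2_eq_square algebra_simps)
      then show ?thesis
        using t(1)[of k] by simp
    qed
    then show "\<exists>N. \<forall>k\<ge>N. f' xbar (h k) \<le> t k * (\<epsilon> k - rf k)"
      by blast
  qed
  ultimately have "u \<in> critical_cone f F \<Omega> xbar"
    by (simp add: critical_cone_def linearized_cone_def jac grad K w_def)
  then obtain lam0 lam where lam0: "lam0 \<ge> 0" and lam: "lam \<in> frechet_multipliers f F \<Omega> (I u) lam0 xbar u"
    and pos: "u \<bullet> (hessian (\<lambda>x. lagrangian f F x lam0 lam) xbar *v u) > 0"
    using mult h(2) by blast
  have normal: "lam \<in> frechet_normal_cone w K"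
    and stat: "lam0 * f' xbar v + lam \<bullet> F' xbar v = 0" for v
    using lam lagrangian_derivatives(1)[OF f' f'' F' F'', of lam0 lam v]
    by (auto simp: frechet_multipliers_def jac K w_def)
  have K_polyhedral: "finite_union_polyhedra K"
    unfolding K_def by (rule finite_union_polyhedra_radial_cone[OF \<Omega>(1)])
  obtain \<rho> where \<rho>: "\<rho> > 0" "\<And>h. norm h < \<rho> \<Longrightarrow> w + h \<in> K \<Longrightarrow> lam \<bullet> h \<le> 0"
    using frechet_normal_cone_locally_conic[OF finite_union_polyhedra_locally_conic[OF K_polyhedral] normal]
    by metis
  \<comment> \<open>The ray through \<open>w\<close> lies in the cone \<open>K\<close> on both sides
    of \<open>w\<close>, so the normal inequality applies to small positive and negative multiples
    of \<open>w\<close>.\<close>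
  have "lam \<bullet> w = 0"
  proof -
    define s where "s = min (1/2) (\<rho> / (2 * (norm w + 1)))"
    have s: "0 < s" "s < 1" "s * norm w < \<rho>"
    proof -
      have "0 < norm w + 1"
        by (simp add: add_nonneg_pos)
      then show "0 < s" "s < 1"
        using \<rho>(1) by (auto simp: s_def min_def)
      have "s * norm w \<le> \<rho> / (2 * (norm w + 1)) * norm w"
        by (intro mult_right_mono) (auto simp: s_def)
      also have "\<dots> < \<rho>"
        using \<open>0 < norm w + 1\<close> \<rho>(1) by (simp add: field_simps add_nonneg_pos)
      finally show "s * norm w < \<rho>" .
    qed
    have "w + s *\<^sub>R w = (1 + s) *\<^sub>R w" "w + - (s *\<^sub>R w) = (1 - s) *\<^sub>R w"
      by (simp_all add: algebra_simps)
    then have "w + s *\<^sub>R w \<in> K" "w + - (s *\<^sub>R w) \<in> K"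
      using \<open>w \<in> K\<close> s unfolding K_def by (simp_all only:) (intro radial_cone_scaleR; simp)+
    then have "lam \<bullet> (s *\<^sub>R w) \<le> 0" "lam \<bullet> (- (s *\<^sub>R w)) \<le> 0"
      using \<rho>(2)[of "s *\<^sub>R w"] \<rho>(2)[of "- (s *\<^sub>R w)"] s by simp_all
    then show ?thesis
      using s(1) by (simp add: mult_le_0_iff zero_le_mult_iff)
  qed
  obtain \<sigma> where \<sigma>: "\<sigma> > 0" "\<And>v. norm v < \<sigma> \<Longrightarrow> F xbar + v \<in> \<Omega> \<longleftrightarrow> v \<in> K"
    using locally_conic_radial_cone[OF finite_union_polyhedra_locally_conic[OF \<Omega>(1)]]
    unfolding K_def by metis
  have "(\<lambda>k. norm (t k *\<^sub>R d k)) \<longlonglongrightarrow> norm (0 *\<^sub>R w)"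
    by (intro tendsto_intros t d)
  then have "\<forall>\<^sub>F k in sequentially. norm (t k *\<^sub>R d k) < \<sigma>"
    using \<sigma>(1) by (intro order_tendstoD) auto
  moreover have "\<forall>\<^sub>F k in sequentially. norm (d k - w) < \<rho>"
    using d \<rho>(1) by (simp add: tendsto_iff dist_norm)
  \<comment> \<open>Add the normal inequality for \<open>d k\<close> to \<open>lam0\<close> times
    the objective estimate. Stationarity cancels the first-order terms, and the rest is divided by
    \<open>t k\<close>.\<close>
  ultimately have "\<forall>\<^sub>F k in sequentially. lam0 * rf k + lam \<bullet> rF k \<le> lam0 * \<epsilon> k + norm lam * \<epsilon> k"
  proof eventually_elim
    case (elim k)
    have "t k *\<^sub>R d k \<in> K"
      using \<sigma>(2)[OF elim(1)] y(1)[of k] by (simp add: y_eq)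
    then have "d k \<in> K"
      by (simp add: K_def radial_cone_scaleR_iff[OF t(1)])
    then have "lam \<bullet> d k \<le> 0"
      using \<rho>(2)[OF elim(2)] \<open>lam \<bullet> w = 0\<close> by (simp add: inner_diff_right)
    then have "lam \<bullet> F' xbar (h k) + t k * (lam \<bullet> rF k) \<le> - (t k * (lam \<bullet> r k))"
      by (simp add: d_def inner_add_right algebra_simps)
    also have "\<dots> \<le> t k * (norm lam * \<epsilon> k)"
    proof -
      have "- (lam \<bullet> r k) \<le> norm lam * norm (r k)"
        using norm_cauchy_schwarz[of lam "- r k"] by simp
      also have "\<dots> \<le> norm lam * \<epsilon> k"
        by (simp add: mult_left_mono r_le)
      finally show ?thesis
        using mult_left_mono[of _ _ "t k"] t(1)[of k] by fastforce
    qed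
    finally have 1: "lam \<bullet> F' xbar (h k) + t k * (lam \<bullet> rF k) \<le> t k * (norm lam * \<epsilon> k)" .
    have "t k * f' xbar (h k) + (t k)\<^sup>2 * rf k \<le> \<epsilon> k * (t k)\<^sup>2"
      using \<epsilon>(2)[of k] by (simp add: f_eq)
    then have "t k * (f' xbar (h k) + t k * rf k) \<le> t k * (t k * \<epsilon> k)"
      by (simp add: power2_eq_square algebra_simps)
    then have "f' xbar (h k) + t k * rf k \<le> t k * \<epsilon> k"
      using t(1)[of k] by simp
    then have "lam0 * (f' xbar (h k) + t k * rf k) \<le> lam0 * (t k * \<epsilon> k)"
      using lam0 by (rule mult_left_mono)
    then have "t k * (lam0 * rf k + lam \<bullet> rF k) \<le> t k * (lam0 * \<epsilon> k + norm lam * \<epsilon> k)"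
      using 1 stat[of "h k"] by (simp add: algebra_simps)
    then show ?case
      using t(1)[of k] by simp
  qed
  moreover have "(\<lambda>k. lam0 * rf k + lam \<bullet> rF k)
      \<longlonglongrightarrow> lam0 * ((1/2) *\<^sub>R f'' u u) + lam \<bullet> ((1/2) *\<^sub>R F'' u u)"
    by (intro tendsto_intros rf rF)
  moreover have "(\<lambda>k. lam0 * \<epsilon> k + norm lam * \<epsilon> k) \<longlonglongrightarrow> lam0 * 0 + norm lam * 0"
    by (intro tendsto_intros \<epsilon>(1))
  ultimately have "lam0 * ((1/2) *\<^sub>R f'' u u) + lam \<bullet> ((1/2) *\<^sub>R F'' u u) \<le> lam0 * 0 + norm lam * 0"
    by (intro tendsto_le[OF sequentially_bot])
  then show False
    using pos lagrangian_derivatives(2)[OF f' f'' F' F'', of u lam0 lam] by simp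
qed

subsection \<open>Necessary condition\<close>

text \<open>
  \<open>R\<close> is the contingent cone at \<open>w\<close> of the contingent cone of \<open>C\<close> at \<open>b\<close>; for a piecewise
  polyhedral \<open>C\<close> it describes \<open>C\<close> exactly near the ray from \<open>b\<close> in direction \<open>w\<close>.
\<close>

definition second_order_tangent ::
    "'a::real_normed_vector \<Rightarrow> 'a \<Rightarrow> 'a set \<Rightarrow> 'a set \<Rightarrow> bool" where
  "second_order_tangent b w C R \<longleftrightarrow>
     (\<exists>\<tau>>0. \<exists>r>0. \<forall>t s y. 0 < t \<longrightarrow> t \<le> \<tau> \<longrightarrow> 0 < s \<longrightarrow> norm (s *\<^sub>R y) < r \<longrightarrow>
        (b + t *\<^sub>R (w + s *\<^sub>R y) \<in> C \<longleftrightarrow> y \<in> R))"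

text \<open>Conicity at \<open>b\<close> moves a point on scale \<open>t\<close> to scale \<tau>;
  the local cone at \<open>b + \<tau> *\<^sub>R w\<close> then describes \<open>C\<close>, and its
  scaling invariance removes \<open>\<tau> * s\<close>. All small \<tau> work, so a single \<tau>
  can later serve both \<Omega> and its second factor.\<close>

lemma radial_cone_second_order_tangent:
  fixes C :: "'a::euclidean_space set"
  assumes "finite_union_polyhedra C"
  obtains T where "T > 0"
    "\<And>\<tau>. 0 < \<tau> \<Longrightarrow> \<tau> \<le> T \<Longrightarrow> second_order_tangent b w C (radial_cone (b + \<tau> *\<^sub>R w) C)"
proof -
  obtain r1 where r1: "r1 > 0"
    "\<And>w t. norm w < r1 \<Longrightarrow> 0 < t \<Longrightarrow> t \<le> 1 \<Longrightarrow> b + w \<in> C \<longleftrightarrow> b + t *\<^sub>R w \<in> C"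
    using locally_conic_radial_cone[OF finite_union_polyhedra_locally_conic[OF assms]] by metis
  define T where "T = r1 / (2 * (norm w + 1))"
  have w1: "0 < norm w + 1"
    by (simp add: add_nonneg_pos)
  then have "T > 0"
    using r1(1) by (simp add: T_def)
  moreover have "second_order_tangent b w C (radial_cone (b + \<tau> *\<^sub>R w) C)" if \<tau>: "0 < \<tau>" "\<tau> \<le> T" for \<tau>
  proof -
    obtain r2 where r2: "r2 > 0"
      "\<And>v. norm v < r2 \<Longrightarrow> b + \<tau> *\<^sub>R w + v \<in> C \<longleftrightarrow> v \<in> radial_cone (b + \<tau> *\<^sub>R w) C"
      using locally_conic_radial_cone[OF finite_union_polyhedra_locally_conic[OF assms]] by metis
    have "\<tau> * norm w \<le> T * (norm w + 1)"
      using \<tau> by (intro mult_mono) auto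
    also have "T * (norm w + 1) = r1 / 2"
      using w1 by (simp add: T_def nonzero_divide_eq_eq)
    finally have \<tau>w: "\<tau> * norm w \<le> r1 / 2" .
    \<comment> \<open>After scaling by \<tau>, the bound \<open>r1 / 2\<close> leaves room for
      \<open>\<tau> * norm w \<le> r1 / 2\<close> in the ball at \<open>b\<close>, and
      \<open>r2\<close> is the radius at \<open>b + \<tau> *\<^sub>R w\<close>.\<close>
    define r where "r = min (r1 / 2) r2 / \<tau>"
    have "r > 0"
      using r1(1) r2(1) \<tau>(1) by (simp add: r_def)
    moreover have "b + t *\<^sub>R (w + s *\<^sub>R y) \<in> C \<longleftrightarrow> y \<in> radial_cone (b + \<tau> *\<^sub>R w) C"
      if t: "0 < t" "t \<le> \<tau>" and s: "0 < s" "norm (s *\<^sub>R y) < r" for t s y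
    proof -
      have sy: "norm (\<tau> *\<^sub>R s *\<^sub>R y) < r1 / 2" "norm (\<tau> *\<^sub>R s *\<^sub>R y) < r2"
        using s \<tau>(1) by (simp_all add: r_def pos_less_divide_eq mult_ac)
      have "norm (\<tau> *\<^sub>R (w + s *\<^sub>R y)) \<le> norm (\<tau> *\<^sub>R w) + norm (\<tau> *\<^sub>R s *\<^sub>R y)"
        unfolding scaleR_add_right by (rule norm_triangle_ineq)
      also have "\<dots> < r1"
        using sy(1) \<tau>w \<tau>(1) by simp
      finally have "b + \<tau> *\<^sub>R (w + s *\<^sub>R y) \<in> C \<longleftrightarrow> b + (t / \<tau>) *\<^sub>R \<tau> *\<^sub>R (w + s *\<^sub>R y) \<in> C"
        using t \<tau>(1) by (intro r1(2)) auto
      then have "b + t *\<^sub>R (w + s *\<^sub>R y) \<in> C \<longleftrightarrow> b + \<tau> *\<^sub>R w + \<tau> *\<^sub>R s *\<^sub>R y \<in> C"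
        using \<tau>(1) by (simp add: scaleR_add_right add.assoc)
      also have "\<dots> \<longleftrightarrow> (\<tau> * s) *\<^sub>R y \<in> radial_cone (b + \<tau> *\<^sub>R w) C"
        using r2(2)[OF sy(2)] by simp
      also have "\<dots> \<longleftrightarrow> y \<in> radial_cone (b + \<tau> *\<^sub>R w) C"
        using \<tau>(1) s(1) by (intro radial_cone_scaleR_iff) simp
      finally show ?thesis .
    qed
    ultimately show ?thesis
      unfolding second_order_tangent_def using \<tau>(1) by blast
  qed
  ultimately show ?thesis
    using that by blast
qed

lemma second_order_tangent_eventually:
  assumes "second_order_tangent b w C R" "(t \<longlongrightarrow> 0) F" "\<forall>\<^sub>F k in F. t k > 0" "(y \<longlongrightarrow> y0) F"
  shows "\<forall>\<^sub>F k in F. b + t k *\<^sub>R (w + t k *\<^sub>R y k) \<in> C \<longleftrightarrow> y k \<in> R"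
proof -
  obtain \<tau> r where \<tau>: "\<tau> > 0" "r > 0" "\<And>t s y. 0 < t \<Longrightarrow> t \<le> \<tau> \<Longrightarrow> 0 < s \<Longrightarrow> norm (s *\<^sub>R y) < r \<Longrightarrow>
        (b + t *\<^sub>R (w + s *\<^sub>R y) \<in> C \<longleftrightarrow> y \<in> R)"
    using assms(1) unfolding second_order_tangent_def by blast
  have "((\<lambda>k. norm (t k *\<^sub>R y k)) \<longlongrightarrow> norm (0 *\<^sub>R y0)) F"
    by (intro tendsto_intros assms)
  then have "\<forall>\<^sub>F k in F. norm (t k *\<^sub>R y k) < r"
    using \<tau>(2) by (intro order_tendstoD) auto
  moreover have "\<forall>\<^sub>F k in F. t k < \<tau>"
    using assms(2) \<tau>(1) by (rule order_tendstoD)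
  ultimately show ?thesis
    using assms(3)
  proof eventually_elim
    case (elim k)
    then show ?case
      using \<tau>(3)[of "t k" "t k" "y k"] by simp
  qed
qed

section \<open>Directional normals from proximal inequalities\<close>

lemma frechet_normal_coneI:
  assumes "z \<in> C" "r > 0" "\<And>h. norm h < r \<Longrightarrow> z + h \<in> C \<Longrightarrow> \<xi> \<bullet> h \<le> M * (norm h)\<^sup>2"
  shows "\<xi> \<in> frechet_normal_cone z C"
proof -
  have "\<forall>\<^sub>F z' in at z within C. ereal (\<xi> \<bullet> (z' - z) / norm (z' - z)) < y" if "y > 0" for y
  proof -
    obtain e where e: "0 < e" "ereal e < y"
      using ereal_dense2[OF \<open>y > 0\<close>] by auto
    define d where "d = min r (e / (\<bar>M\<bar> + 1))"
    have "d > 0"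
      using assms(2) e(1) by (simp add: d_def add_nonneg_pos)
    moreover have "ereal (\<xi> \<bullet> (z' - z) / norm (z' - z)) < y"
      if z': "z' \<in> C" "z' \<noteq> z" "dist z' z < d" for z'
    proof -
      define n where "n = norm (z' - z)"
      have n: "0 < n" "n < r" "n < e / (\<bar>M\<bar> + 1)"
        using z' by (auto simp: n_def d_def dist_norm)
      have "\<xi> \<bullet> (z' - z) \<le> M * n\<^sup>2"
        using assms(3)[of "z' - z"] z'(1) n(2) by (simp add: n_def)
      also have "\<dots> \<le> ((\<bar>M\<bar> + 1) * n) * n"
        unfolding power2_eq_square using n(1) by (simp add: mult_right_mono flip: mult.assoc)
      also have "\<dots> < e * n"
        using n by (simp add: pos_less_divide_eq add_nonneg_pos mult.commute)
      finally have "\<xi> \<bullet> (z' - z) / n < e"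
        using n(1) by (simp add: divide_less_eq)
      then show ?thesis
        using e(2) by (metis ereal_less_eq(3) less_imp_le n_def order_le_less_trans)
    qed
    ultimately show ?thesis
      unfolding eventually_at by auto
  qed
  then show ?thesis
    using assms(1) by (simp add: frechet_normal_cone_def Limsup_le_iff)
qed

text \<open>Near \<open>b + t *\<^sub>R (w + s *\<^sub>R z)\<close> the set \<open>C\<close> is a
  copy of \<open>R\<close> near \<open>z\<close>, scaled by \<open>t * s\<close>. The proximal
  inequality survives with constant \<open>M / (t * s)\<close>, so the same \<xi> is a Frechet
  normal at all these points; let \<open>t\<close> and \<open>s\<close> tend to 0.\<close>

lemma directional_normal_coneI:
  assumes R: "second_order_tangent b w C R" and "z \<in> R"
    and prox: "\<And>y. y \<in> R \<Longrightarrow> \<xi> \<bullet> (y - z) \<le> M * (norm (y - z))\<^sup>2"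
  shows "\<xi> \<in> directional_normal_cone b C w"
proof -
  obtain \<tau> r where \<tau>: "\<tau> > 0" "r > 0" "\<And>t s y. 0 < t \<Longrightarrow> t \<le> \<tau> \<Longrightarrow> 0 < s \<Longrightarrow> norm (s *\<^sub>R y) < r \<Longrightarrow>
        (b + t *\<^sub>R (w + s *\<^sub>R y) \<in> C \<longleftrightarrow> y \<in> R)"
    using R unfolding second_order_tangent_def by blast
  have normal: "\<xi> \<in> frechet_normal_cone (b + t *\<^sub>R (w + s *\<^sub>R z)) C"
    if t: "0 < t" "t \<le> \<tau>" and s: "0 < s" "norm (s *\<^sub>R z) < r" for t s
  proof (rule frechet_normal_coneI)
    show "b + t *\<^sub>R (w + s *\<^sub>R z) \<in> C"
      using \<tau>(3)[OF t s] \<open>z \<in> R\<close> by blast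
    show "0 < t * (r - norm (s *\<^sub>R z))"
      using t(1) s(2) by simp
    fix h assume h: "norm h < t * (r - norm (s *\<^sub>R z))" "b + t *\<^sub>R (w + s *\<^sub>R z) + h \<in> C"
    define y where "y = z + h /\<^sub>R (t * s)"
    have h_eq: "h = (t * s) *\<^sub>R (y - z)"
      using t(1) s(1) by (simp add: y_def field_simps)
    have "s *\<^sub>R y = s *\<^sub>R z + h /\<^sub>R t"
      using s(1) by (simp add: y_def scaleR_add_right)
    then have "norm (s *\<^sub>R y) \<le> norm (s *\<^sub>R z) + norm (h /\<^sub>R t)"
      by (metis norm_triangle_ineq)
    also have "norm (h /\<^sub>R t) < r - norm (s *\<^sub>R z)"
      using h(1) t(1) by (simp add: field_simps)
    finally have "norm (s *\<^sub>R y) < r"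
      by simp
    moreover have "b + t *\<^sub>R (w + s *\<^sub>R y) \<in> C"
      using h(2) t(1) s(1) by (simp add: h_eq algebra_simps)
    ultimately have "y \<in> R"
      using \<tau>(3)[OF t s(1)] by blast
    then have "(t * s) * (\<xi> \<bullet> (y - z)) \<le> (t * s) * (M * (norm (y - z))\<^sup>2)"
      using prox t(1) s(1) by (intro mult_left_mono) auto
    also have "\<dots> = M / (t * s) * (norm h)\<^sup>2"
      using t(1) s(1) by (simp add: h_eq power_mult_distrib power2_eq_square)
    finally show "\<xi> \<bullet> h \<le> M / (t * s) * (norm h)\<^sup>2"
      by (simp add: h_eq)
  qed
  define e where "e n = inverse (real (Suc n))" for n
  have e: "e \<longlonglongrightarrow> 0" "\<And>n. e n > 0" "\<And>n. e n \<le> 1"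
    unfolding e_def using LIMSEQ_inverse_real_of_nat by (auto simp: inverse_le_1_iff)
  \<comment> \<open>With \<open>s = a * e n\<close> the vectors \<open>s *\<^sub>R z\<close> stay
    below \<open>r\<close> in norm for every \<open>n\<close>.\<close>
  define a where "a = r / (norm z + 1)"
  have z1: "0 < norm z + 1"
    by (simp add: add_nonneg_pos)
  have a: "a > 0" "a * norm z < r"
    using \<tau>(2) z1 by (auto simp: a_def field_simps)
  have small: "norm ((a * e n) *\<^sub>R z) < r" for n
  proof -
    have "norm ((a * e n) *\<^sub>R z) = e n * (a * norm z)"
      using a(1) e(2)[of n] by (simp add: abs_mult mult_ac)
    also have "\<dots> \<le> a * norm z"
      using a(1) e(2,3)[of n] by (intro mult_left_le_one_le) (auto simp: less_imp_le)
    finally show ?thesis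
      using a(2) by simp
  qed
  show ?thesis
    unfolding directional_normal_cone_def mem_Collect_eq
  proof (intro exI conjI allI)
    show "(\<lambda>n. \<tau> * e n) \<longlonglongrightarrow> 0"
      by (rule tendsto_eq_rhs[OF tendsto_mult[OF tendsto_const e(1)]]) simp
    have "(\<lambda>n. w + (a * e n) *\<^sub>R z) \<longlonglongrightarrow> w + (a * 0) *\<^sub>R z"
      by (intro tendsto_intros e(1))
    then show "(\<lambda>n. w + (a * e n) *\<^sub>R z) \<longlonglongrightarrow> w"
      by simp
    show "(\<lambda>n. \<xi>) \<longlonglongrightarrow> \<xi>"
      by simp
    show "0 < \<tau> * e n" for n
      using \<tau>(1) e(2) by simp
    show "\<xi> \<in> frechet_normal_cone (b + (\<tau> * e n) *\<^sub>R (w + (a * e n) *\<^sub>R z)) C" for n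
      using \<tau>(1) e(2,3)[of n] a(1) by (intro normal small) (auto simp: mult_left_le)
  qed
qed

text \<open>The second-order arc \<open>xbar + t u + t\<^sup>2 v\<close> would violate quadratic growth.\<close>

lemma essential_minimizer_no_descent_arc:
  fixes f :: "real^'n \<Rightarrow> real" and F :: "real^'n \<Rightarrow> real^'m"
    and f' :: "real^'n \<Rightarrow> (real^'n) \<Rightarrow>\<^sub>L real" and F' :: "real^'n \<Rightarrow> (real^'n) \<Rightarrow>\<^sub>L (real^'m)"
  assumes f': "\<forall>\<^sub>F y in nhds xbar. (f has_derivative blinfun_apply (f' y)) (at y)"
    and f'': "(f' has_derivative f'') (at xbar)"
    and F': "\<forall>\<^sub>F y in nhds xbar. (F has_derivative blinfun_apply (F' y)) (at y)"
    and F'': "(F' has_derivative F'') (at xbar)"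
    and ess: "essential_local_minimizer_second_order f F \<Omega> xbar"
    and R: "second_order_tangent (F xbar) (F' xbar u) \<Omega> R"
    and "u \<noteq> 0" and z: "F' xbar v + (1/2) *\<^sub>R F'' u u \<in> R"
    and descent: "f' xbar u < 0 \<or> f' xbar u = 0 \<and> f' xbar v + f'' u u / 2 \<le> 0"
  shows False
proof -
  define t where "t n = inverse (real (Suc n))" for n
  have t: "t \<longlonglongrightarrow> 0" "\<And>n. t n > 0"
    unfolding t_def using LIMSEQ_inverse_real_of_nat by auto
  define h where "h n = u + t n *\<^sub>R v" for n
  have "h \<longlonglongrightarrow> u + 0 *\<^sub>R v"
    unfolding h_def by (intro tendsto_intros t)
  then have h: "h \<longlonglongrightarrow> u"
    by simp
  define x where "x n = xbar + t n *\<^sub>R h n" for n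
  have "x \<longlonglongrightarrow> xbar + 0 *\<^sub>R u"
    unfolding x_def by (intro tendsto_intros t h)
  then have x: "x \<longlonglongrightarrow> xbar"
    by simp
  obtain U \<beta> where U: "open U" "xbar \<in> U" "\<beta> > 0"
    "\<And>x. x \<in> U \<Longrightarrow> max (f x - f xbar) (infdist (F x) \<Omega>) \<ge> \<beta> * (norm (x - xbar))\<^sup>2"
    using ess unfolding essential_local_minimizer_second_order_def by blast
  define rf where "rf k = (f (x k) - f xbar - t k *\<^sub>R f' xbar (h k)) /\<^sub>R (t k)\<^sup>2" for k
  define rF where "rF k = (F (x k) - F xbar - t k *\<^sub>R F' xbar (h k)) /\<^sub>R (t k)\<^sup>2" for k
  have rf: "rf \<longlonglongrightarrow> (1/2) *\<^sub>R f'' u u"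
    unfolding rf_def x_def using t h(1) by (intro second_order_limit[OF f' f'']) auto
  have rF: "rF \<longlonglongrightarrow> (1/2) *\<^sub>R F'' u u"
    unfolding rF_def x_def using t h(1) by (intro second_order_limit[OF F' F'']) auto
  have f_eq: "f (x k) - f xbar = t k * f' xbar u + (t k)\<^sup>2 * (f' xbar v + rf k)" for k
    using t(2)[of k]
    by (simp add: rf_def h_def blinfun.add_right blinfun.scaleR_right field_simps power2_eq_square)
  have F_eq: "F (x k) = F xbar + t k *\<^sub>R (F' xbar u + t k *\<^sub>R (F' xbar v + rF k))" for k
  proof -
    have "F (x k) = F xbar + t k *\<^sub>R F' xbar (h k) + (t k)\<^sup>2 *\<^sub>R rF k"
      using t(2)[of k] by (simp add: rF_def)
    then show ?thesis
      by (simp add: h_def blinfun.add_right blinfun.scaleR_right power2_eq_square algebra_simps)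
  qed
  \<comment> \<open>Both descent cases are reduced to one bound on scale t^2: if the first-order
    term is negative, the bound 0 holds eventually; otherwise it vanishes and \<alpha> is the
    second-order quotient.\<close>
  have "\<exists>\<alpha> a. (\<alpha> \<longlonglongrightarrow> a) \<and> a \<le> 0 \<and> (\<forall>\<^sub>F k in sequentially. f (x k) - f xbar \<le> (t k)\<^sup>2 * \<alpha> k)"
  proof (cases "f' xbar u < 0")
    case True
    have "(\<lambda>k. f' xbar u + t k * (f' xbar v + rf k)) \<longlonglongrightarrow> f' xbar u + 0 * (f' xbar v + (1/2) *\<^sub>R f'' u u)"
      by (intro tendsto_intros t rf)
    then have "\<forall>\<^sub>F k in sequentially. f' xbar u + t k * (f' xbar v + rf k) < 0"
      using True by (intro order_tendstoD) auto
    then have "\<forall>\<^sub>F k in sequentially. f (x k) - f xbar \<le> (t k)\<^sup>2 * 0"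
    proof eventually_elim
      case (elim k)
      have "f (x k) - f xbar = t k * (f' xbar u + t k * (f' xbar v + rf k))"
        by (simp add: f_eq power2_eq_square algebra_simps)
      then show ?case
        using elim t(2)[of k] by (simp add: mult_le_0_iff)
    qed
    then show ?thesis
      by (intro exI[of _ "\<lambda>_. 0"] exI[of _ 0]) simp
  next
    case False
    have "(\<lambda>k. f' xbar v + rf k) \<longlonglongrightarrow> f' xbar v + (1/2) *\<^sub>R f'' u u"
      by (intro tendsto_intros rf)
    then show ?thesis
      using descent False
      by (intro exI[of _ "\<lambda>k. f' xbar v + rf k"] exI[of _ "f' xbar v + (1/2) *\<^sub>R f'' u u"]) (simp add: f_eq)
  qed
  then obtain \<alpha> a where \<alpha>: "\<alpha> \<longlonglongrightarrow> a" "a \<le> 0"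
    "\<forall>\<^sub>F k in sequentially. f (x k) - f xbar \<le> (t k)\<^sup>2 * \<alpha> k"
    by blast
  define z where "z = F' xbar v + (1/2) *\<^sub>R F'' u u"
  have "\<forall>\<^sub>F k in sequentially. F xbar + t k *\<^sub>R (F' xbar u + t k *\<^sub>R z) \<in> \<Omega> \<longleftrightarrow> z \<in> R"
    using t by (intro second_order_tangent_eventually[OF R]) auto
  moreover have "\<forall>\<^sub>F k in sequentially. x k \<in> U"
    using x U(1,2) by (rule topological_tendstoD)
  ultimately have "\<forall>\<^sub>F k in sequentially. \<beta> * (norm (h k))\<^sup>2 \<le> max (\<alpha> k) (norm (rF k - (1/2) *\<^sub>R F'' u u))"
    using \<alpha>(3)
  proof eventually_elim
    case (elim k)
    \<comment> \<open>The second-order model of the constraint values along the arc lies in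
      \<Omega>, so the distance is at most the Taylor remainder, which is o(t^2).\<close>
    have "infdist (F (x k)) \<Omega> \<le> dist (F (x k)) (F xbar + t k *\<^sub>R (F' xbar u + t k *\<^sub>R z))"
      using elim(1) assms(8) by (intro infdist_le) (simp add: z_def)
    also have "\<dots> = norm ((t k)\<^sup>2 *\<^sub>R (rF k - (1/2) *\<^sub>R F'' u u))"
      unfolding dist_norm F_eq z_def by (simp add: power2_eq_square algebra_simps)
    finally have "infdist (F (x k)) \<Omega> \<le> (t k)\<^sup>2 * norm (rF k - (1/2) *\<^sub>R F'' u u)"
      by simp
    then have "max (f (x k) - f xbar) (infdist (F (x k)) \<Omega>)
        \<le> (t k)\<^sup>2 * max (\<alpha> k) (norm (rF k - (1/2) *\<^sub>R F'' u u))"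
      using elim(3) by (simp add: max_mult_distrib_left) linarith
    moreover have "(norm (x k - xbar))\<^sup>2 = (t k)\<^sup>2 * (norm (h k))\<^sup>2"
      by (simp add: x_def power_mult_distrib)
    ultimately have "(t k)\<^sup>2 * (\<beta> * (norm (h k))\<^sup>2)
        \<le> (t k)\<^sup>2 * max (\<alpha> k) (norm (rF k - (1/2) *\<^sub>R F'' u u))"
      using order_trans[OF U(4)[OF elim(2)]] by (simp only: mult.left_commute[of \<beta>])
    then show ?case
      using t(2)[of k] by simp
  qed
  moreover have "(\<lambda>k. \<beta> * (norm (h k))\<^sup>2) \<longlonglongrightarrow> \<beta> * (norm u)\<^sup>2"
    by (intro tendsto_intros h)
  moreover have "(\<lambda>k. max (\<alpha> k) (norm (rF k - (1/2) *\<^sub>R F'' u u)))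
      \<longlonglongrightarrow> max a (norm ((1/2) *\<^sub>R F'' u u - (1/2) *\<^sub>R F'' u u))"
    by (intro tendsto_intros \<alpha>(1) rF)
  ultimately have "\<beta> * (norm u)\<^sup>2 \<le> max a (norm ((1/2) *\<^sub>R F'' u u - (1/2) *\<^sub>R F'' u u))"
    by (intro tendsto_le[OF sequentially_bot])
  then have "\<beta> * (norm u)\<^sup>2 \<le> 0"
    using \<alpha>(2) by simp
  then show False
    using U(3) \<open>u \<noteq> 0\<close> by (simp add: mult_le_0_iff)
qed

section \<open>Second-order consequences of directional subregularity\<close>

text \<open>The angular condition is positively homogeneous, so \<open>t k\<close> cancels. For
  \<open>h = u\<close> its left side is zero while the right side is positive, hence it persists for
  nearby directions.\<close>

lemma directional_nbhd_eventually:
  assumes "(t \<longlongrightarrow> 0) F" "\<forall>\<^sub>F k in F. t k > 0" "(h \<longlongrightarrow> u) F" "u \<noteq> 0" "\<rho> > 0" "\<delta> > 0"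
  shows "\<forall>\<^sub>F k in F. t k *\<^sub>R h k \<in> directional_nbhd \<rho> \<delta> u"
proof -
  have "((\<lambda>k. norm (t k *\<^sub>R h k)) \<longlongrightarrow> norm (0 *\<^sub>R u)) F"
    by (intro tendsto_intros assms)
  then have small: "\<forall>\<^sub>F k in F. norm (t k *\<^sub>R h k) < \<rho>"
    using assms(5) by (intro order_tendstoD) auto
  have lim: "((\<lambda>k. \<delta> * norm (h k) * norm u - norm (norm u *\<^sub>R h k - norm (h k) *\<^sub>R u))
      \<longlongrightarrow> \<delta> * norm u * norm u - norm (norm u *\<^sub>R u - norm u *\<^sub>R u)) F"
    by (intro tendsto_intros assms)
  have "\<forall>\<^sub>F k in F. 0 < \<delta> * norm (h k) * norm u - norm (norm u *\<^sub>R h k - norm (h k) *\<^sub>R u)"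
    using assms(4,6) by (intro order_tendstoD(1)[OF lim]) auto
  with small show ?thesis
    using assms(2)
  proof eventually_elim
    case (elim k)
    have "norm u *\<^sub>R t k *\<^sub>R h k - norm (t k *\<^sub>R h k) *\<^sub>R u
        = t k *\<^sub>R (norm u *\<^sub>R h k - norm (h k) *\<^sub>R u)"
      using elim(3) by (simp add: algebra_simps)
    then have "norm (norm u *\<^sub>R t k *\<^sub>R h k - norm (t k *\<^sub>R h k) *\<^sub>R u)
        = t k * norm (norm u *\<^sub>R h k - norm (h k) *\<^sub>R u)"
      using elim(3) by simp
    also have "\<dots> \<le> t k * (\<delta> * norm (h k) * norm u)"
      using elim(2,3) by (intro mult_left_mono) auto
    finally show ?case
      using elim(1,3) by (simp add: directional_nbhd_def mult_ac)
  qed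
qed

text \<open>
  Subregularity moves each point of the arc \<open>xbar + t u + t\<^sup>2 v\<close> into the constraint set at cost
  \<open>O(t\<^sup>2)\<close>; a cluster point of the rescaled corrections solves the second-order system.
\<close>

lemma subregular_second_order_error_bound:
  fixes G :: "'a::euclidean_space \<Rightarrow> 'b::euclidean_space" and G' :: "'a \<Rightarrow> 'a \<Rightarrow>\<^sub>L 'b"
  assumes G': "\<forall>\<^sub>F y in nhds xbar. (G has_derivative blinfun_apply (G' y)) (at y)"
    and G'': "(G' has_derivative G'') (at xbar)"
    and cont: "continuous_on UNIV G"
    and C: "closed C" "closed R"
    and sub: "metrically_subregular_in_direction (\<lambda>x. {G x - y |y. y \<in> C}) u xbar 0"
    and R: "second_order_tangent (G xbar) (G' xbar u) C R"
    and "u \<noteq> 0"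
  shows "\<exists>\<kappa>. \<forall>v. \<forall>z\<in>R. \<exists>v'. G' xbar v' + (1/2) *\<^sub>R G'' u u \<in> R \<and>
           norm (v' - v) \<le> \<kappa> * norm (G' xbar v + (1/2) *\<^sub>R G'' u u - z)"
proof -
  obtain \<rho> \<delta> \<kappa> where \<kappa>: "\<rho> > 0" "\<delta> > 0" "\<kappa> > 0" and mem: "0 \<in> {G xbar - y |y. y \<in> C}"
    and bound: "\<And>z. z \<in> directional_nbhd \<rho> \<delta> u \<Longrightarrow> {G (xbar + z) - y |y. y \<in> C} \<noteq> {} \<Longrightarrow>
        infdist (xbar + z) {x. 0 \<in> {G x - y |y. y \<in> C}}
          \<le> \<kappa> * infdist 0 {G (xbar + z) - y |y. y \<in> C}"
    using sub unfolding metrically_subregular_in_direction_def by blast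
  define S where "S = {x. G x \<in> C}"
  have S: "{x. 0 \<in> {G x - y |y. y \<in> C}} = S"
    by (auto simp: S_def)
  have "xbar \<in> S"
    using mem by (auto simp: S_def)
  have "closed S"
    using continuous_closed_vimage[OF C(1), of G] cont
    by (simp add: S_def vimage_def continuous_on_eq_continuous_at)
  have "\<exists>v'. G' xbar v' + (1/2) *\<^sub>R G'' u u \<in> R \<and>
           norm (v' - v) \<le> \<kappa> * norm (G' xbar v + (1/2) *\<^sub>R G'' u u - z)" if "z \<in> R" for v z
  proof -
    define t where "t n = inverse (real (Suc n))" for n
    have t: "t \<longlonglongrightarrow> 0" "\<And>n. t n > 0"
      unfolding t_def using LIMSEQ_inverse_real_of_nat by auto
    define h where "h n = u + t n *\<^sub>R v" for n
    have "h \<longlonglongrightarrow> u + 0 *\<^sub>R v"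
      unfolding h_def by (intro tendsto_intros t)
    then have h: "h \<longlonglongrightarrow> u"
      by simp
    define rG where "rG k = (G (xbar + t k *\<^sub>R h k) - G xbar - t k *\<^sub>R G' xbar (h k)) /\<^sub>R (t k)\<^sup>2" for k
    have rG: "rG \<longlonglongrightarrow> (1/2) *\<^sub>R G'' u u"
      unfolding rG_def using t h by (intro second_order_limit[OF G' G'']) auto
    have G_eq: "G (xbar + t k *\<^sub>R h k) = G xbar + t k *\<^sub>R (G' xbar u + t k *\<^sub>R (G' xbar v + rG k))" for k
    proof -
      have "G (xbar + t k *\<^sub>R h k) = G xbar + t k *\<^sub>R G' xbar (h k) + (t k)\<^sup>2 *\<^sub>R rG k"
        using t(2)[of k] by (simp add: rG_def)
      then show ?thesis
        by (simp add: h_def blinfun.add_right blinfun.scaleR_right power2_eq_square algebra_simps)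
    qed
    define e where "e k = norm (G' xbar v + rG k - z)" for k
    have e: "e \<longlonglongrightarrow> norm (G' xbar v + (1/2) *\<^sub>R G'' u u - z)"
      unfolding e_def by (intro tendsto_intros rG)
    have "\<forall>\<^sub>F k in sequentially. t k *\<^sub>R h k \<in> directional_nbhd \<rho> \<delta> u"
      using t h \<open>u \<noteq> 0\<close> \<kappa> by (intro directional_nbhd_eventually) auto
    moreover have "\<forall>\<^sub>F k in sequentially. G xbar + t k *\<^sub>R (G' xbar u + t k *\<^sub>R z) \<in> C \<longleftrightarrow> z \<in> R"
      using t by (intro second_order_tangent_eventually[OF R]) auto
    ultimately have "\<forall>\<^sub>F k in sequentially. \<exists>d. norm d \<le> \<kappa> * e k \<and>
        G (xbar + t k *\<^sub>R (u + t k *\<^sub>R (v + d))) \<in> C"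
    proof eventually_elim
      case (elim k)
      define y where "y = G xbar + t k *\<^sub>R (G' xbar u + t k *\<^sub>R z)"
      have y: "y \<in> C"
        using elim(2) \<open>z \<in> R\<close> by (simp add: y_def)
      define x where "x = xbar + t k *\<^sub>R h k"
      have "infdist x S \<le> \<kappa> * infdist 0 {G x - y |y. y \<in> C}"
        using bound[OF elim(1)] y unfolding S x_def by blast
      also have "infdist 0 {G x - y |y. y \<in> C} \<le> dist 0 (G x - y)"
        using y by (intro infdist_le) blast
      also have "dist 0 (G x - y) = norm ((t k)\<^sup>2 *\<^sub>R (G' xbar v + rG k - z))"
        unfolding x_def G_eq y_def by (simp add: power2_eq_square algebra_simps)
      also have "\<dots> = (t k)\<^sup>2 * e k"
        by (simp add: e_def)
      finally have inf: "infdist x S \<le> \<kappa> * ((t k)\<^sup>2 * e k)"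
        using \<kappa>(3) by simp
      obtain x' where x': "x' \<in> S" "infdist x S = dist x x'"
        using infdist_attains_inf[OF \<open>closed S\<close>] \<open>xbar \<in> S\<close> by blast
      \<comment> \<open>The correction to a nearest point of \<open>S\<close>, measured on the scale
        t^2 of the arc parameter \<open>v\<close>.\<close>
      define d where "d = (x' - x) /\<^sub>R (t k)\<^sup>2"
      have "norm d = dist x x' / (t k)\<^sup>2"
        by (simp add: d_def dist_norm norm_minus_commute divide_inverse mult.commute)
      also have "\<dots> \<le> \<kappa> * e k"
        using inf x'(2) t(2)[of k] by (simp add: divide_le_eq mult_ac)
      finally have "norm d \<le> \<kappa> * e k" .
      moreover have "x' = x + (t k)\<^sup>2 *\<^sub>R d"
        using t(2)[of k] by (simp add: d_def)
      then have "xbar + t k *\<^sub>R (u + t k *\<^sub>R (v + d)) = x'"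
        by (simp add: x_def h_def power2_eq_square algebra_simps)
      ultimately show ?case
        using x'(1) by (auto simp: S_def)
    qed
    then obtain N where "\<And>k. k \<ge> N \<Longrightarrow> \<exists>d. norm d \<le> \<kappa> * e k \<and>
        G (xbar + t k *\<^sub>R (u + t k *\<^sub>R (v + d))) \<in> C"
      unfolding eventually_sequentially by blast
    then have "\<forall>k. \<exists>d. norm d \<le> \<kappa> * e (k + N) \<and>
        G (xbar + t (k + N) *\<^sub>R (u + t (k + N) *\<^sub>R (v + d))) \<in> C"
      by simp
    then obtain d where d: "\<And>k. norm (d k) \<le> \<kappa> * e (k + N)"
      "\<And>k. G (xbar + t (k + N) *\<^sub>R (u + t (k + N) *\<^sub>R (v + d k))) \<in> C"
      by metis
    have eN: "(\<lambda>k. e (k + N)) \<longlonglongrightarrow> norm (G' xbar v + (1/2) *\<^sub>R G'' u u - z)"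
      using e by (rule LIMSEQ_ignore_initial_segment)
    then obtain B where B: "\<And>k. norm (e (k + N)) \<le> B"
      using convergent_imp_Bseq[OF convergentI[OF eN]] unfolding Bseq_def by blast
    have "norm (d k) \<le> \<kappa> * B" for k
    proof -
      have "e (k + N) \<le> B"
        using B[of k] by (simp add: abs_le_iff)
      then have "\<kappa> * e (k + N) \<le> \<kappa> * B"
        using \<kappa>(3) by simp
      then show ?thesis
        using d(1)[of k] by linarith
    qed
    \<comment> \<open>Boundedness gives a cluster point \<open>d0\<close>, and \<open>v + d0\<close>
      is the required solution: the expansion is repeated along the corrected arc, and
      \<open>R\<close> is closed.\<close>
    then have "\<forall>k. d k \<in> cball 0 (\<kappa> * B)"
      by (simp add: dist_norm)
    then obtain d0 r where r: "strict_mono r" "(d \<circ> r) \<longlonglongrightarrow> d0"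
      using compact_cball[of "0::'a" "\<kappa> * B"] unfolding compact_def by metis
    define s where "s k = t (r k + N)" for k
    have "(\<lambda>k. t (k + N)) \<longlonglongrightarrow> 0"
      using t(1) by (rule LIMSEQ_ignore_initial_segment)
    then have s: "s \<longlonglongrightarrow> 0" "\<And>k. s k > 0"
      unfolding s_def using LIMSEQ_subseq_LIMSEQ[OF \<open>(\<lambda>k. t (k + N)) \<longlonglongrightarrow> 0\<close> r(1)] t(2)
      by (simp_all add: o_def)
    define dr where "dr = d \<circ> r"
    have dr: "dr \<longlonglongrightarrow> d0"
      using r(2) by (simp only: dr_def)
    define g where "g k = u + s k *\<^sub>R (v + dr k)" for k
    have "g \<longlonglongrightarrow> u + 0 *\<^sub>R (v + d0)"
      unfolding g_def by (intro tendsto_intros s dr)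
    then have g: "g \<longlonglongrightarrow> u"
      by simp
    define q where "q k = (G (xbar + s k *\<^sub>R g k) - G xbar - s k *\<^sub>R G' xbar (g k)) /\<^sub>R (s k)\<^sup>2" for k
    have q: "q \<longlonglongrightarrow> (1/2) *\<^sub>R G'' u u"
      unfolding q_def using s g by (intro second_order_limit[OF G' G'']) auto
    have q_eq: "G (xbar + s k *\<^sub>R g k) = G xbar + s k *\<^sub>R (G' xbar u + s k *\<^sub>R (G' xbar (v + dr k) + q k))" for k
    proof -
      have "G (xbar + s k *\<^sub>R g k) = G xbar + s k *\<^sub>R G' xbar (g k) + (s k)\<^sup>2 *\<^sub>R q k"
        using s(2)[of k] by (simp add: q_def)
      then show ?thesis
        by (simp add: g_def blinfun.add_right blinfun.scaleR_right power2_eq_square algebra_simps)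
    qed
    have lim: "(\<lambda>k. G' xbar (v + dr k) + q k) \<longlonglongrightarrow> G' xbar (v + d0) + (1/2) *\<^sub>R G'' u u"
      by (intro tendsto_intros dr q)
    have "\<forall>\<^sub>F k in sequentially. G xbar + s k *\<^sub>R (G' xbar u + s k *\<^sub>R (G' xbar (v + dr k) + q k)) \<in> C
        \<longleftrightarrow> G' xbar (v + dr k) + q k \<in> R"
      using s by (intro second_order_tangent_eventually[OF R _ _ lim]) auto
    then have "\<forall>\<^sub>F k in sequentially. G' xbar (v + dr k) + q k \<in> R"
    proof eventually_elim
      case (elim k)
      then show ?case
        using d(2)[of "r k"] unfolding q_eq[symmetric] by (simp add: g_def s_def dr_def)
    qed
    then have "G' xbar (v + d0) + (1/2) *\<^sub>R G'' u u \<in> R"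
      by (rule Lim_in_closed_set[OF C(2) _ sequentially_bot lim])
    moreover have "norm d0 \<le> \<kappa> * norm (G' xbar v + (1/2) *\<^sub>R G'' u u - z)"
    proof (rule LIMSEQ_le)
      show "(\<lambda>k. norm (dr k)) \<longlonglongrightarrow> norm d0"
        by (intro tendsto_intros dr)
      show "(\<lambda>k. \<kappa> * e (r k + N)) \<longlonglongrightarrow> \<kappa> * norm (G' xbar v + (1/2) *\<^sub>R G'' u u - z)"
        using LIMSEQ_subseq_LIMSEQ[OF eN r(1)] by (intro tendsto_intros) (simp add: o_def)
      show "\<exists>M. \<forall>k\<ge>M. norm (dr k) \<le> \<kappa> * e (r k + N)"
        using d(1) by (simp add: dr_def)
    qed
    ultimately show ?thesis
      by (intro exI[of _ "v + d0"]) simp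
  qed
  then show ?thesis
    by blast
qed

lemma radial_cone_splitting:
  "y \<in> radial_cone b {y. block I y \<in> C\<^sub>1 \<and> block J y \<in> C\<^sub>2} \<longleftrightarrow>
     block I y \<in> radial_cone (block I b) C\<^sub>1 \<and> block J y \<in> radial_cone (block J b) C\<^sub>2"
  by (simp add: radial_cone_def block_add block_scaleR eventually_conj_iff)

text \<open>The cone \<open>R\<close> at a common \<tau> splits along the blocks, so the error bound
  for the second block can be combined with an unchanged first block.
  \<open>split_multiplier\<close> supplies the multiplier and
  \<open>directional_normal_coneI\<close> its normality.\<close>

lemma multipliers_necessary:
  fixes f :: "real^'n \<Rightarrow> real" and F :: "real^'n \<Rightarrow> real^'m"
    and f' :: "real^'n \<Rightarrow> (real^'n) \<Rightarrow>\<^sub>L real" and F' :: "real^'n \<Rightarrow> (real^'n) \<Rightarrow>\<^sub>L (real^'m)"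
  assumes f': "\<forall>\<^sub>F y in nhds xbar. (f has_derivative blinfun_apply (f' y)) (at y)"
    and f'': "(f' has_derivative f'') (at xbar)"
    and F': "\<forall>\<^sub>F y in nhds xbar. (F has_derivative blinfun_apply (F' y)) (at y)"
    and F'': "(F' has_derivative F'') (at xbar)"
    and cont: "continuous_on UNIV F"
    and \<Omega>: "finite_union_polyhedra \<Omega>" "F xbar \<in> \<Omega>"
    and split: "admissible_splitting F \<Omega> xbar u I"
    and ess: "essential_local_minimizer_second_order f F \<Omega> xbar"
    and u: "u \<in> critical_cone f F \<Omega> xbar" "u \<noteq> 0"
  shows "\<exists>lam0\<ge>0. \<exists>lam\<in>multipliers f F \<Omega> I lam0 xbar u.
           u \<bullet> (hessian (\<lambda>x. lagrangian f F x lam0 lam) xbar *v u) > 0"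
proof -
  define b where "b = F xbar"
  define w where "w = F' xbar u"
  define q where "q = (1/2) *\<^sub>R F'' u u"
  have jac: "jacobian F (at xbar) *v v = F' xbar v" for v
    by (rule jacobian_vector_mult[OF eventually_nhds_x_imp_x[OF F']])
  have grad: "gradient f xbar \<bullet> v = f' xbar v" for v
    by (rule gradient_inner[OF eventually_nhds_x_imp_x[OF f']])
  have w: "w \<in> radial_cone b \<Omega>" and fu: "f' xbar u \<le> 0"
    using u(1) contingent_cone_eq_radial_cone[OF \<Omega>]
    by (auto simp: critical_cone_def linearized_cone_def jac grad w_def b_def)
  obtain \<Omega>\<^sub>1 \<Omega>\<^sub>2 where \<Omega>\<^sub>2: "finite_union_polyhedra \<Omega>\<^sub>2"
    and \<Omega>_eq: "\<Omega> = {y. block I y \<in> \<Omega>\<^sub>1 \<and> block (- I) y \<in> \<Omega>\<^sub>2}"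
    and sub: "metrically_subregular_in_direction
             (\<lambda>x. {block (- I) (F x) - y | y. y \<in> \<Omega>\<^sub>2}) u xbar 0"
    using split unfolding admissible_splitting_def by blast
  obtain T0 where T0: "T0 > 0" "\<And>t. 0 < t \<Longrightarrow> t < T0 \<Longrightarrow> b + t *\<^sub>R w \<in> \<Omega>"
    using w unfolding radial_cone_def eventually_at_right_field by auto
  obtain T1 where T1: "T1 > 0"
    "\<And>\<tau>. 0 < \<tau> \<Longrightarrow> \<tau> \<le> T1 \<Longrightarrow> second_order_tangent b w \<Omega> (radial_cone (b + \<tau> *\<^sub>R w) \<Omega>)"
    using radial_cone_second_order_tangent[OF \<Omega>(1)] by metis
  obtain T2 where T2: "T2 > 0"
    "\<And>\<tau>. 0 < \<tau> \<Longrightarrow> \<tau> \<le> T2 \<Longrightarrow> second_order_tangent (block (- I) b) (block (- I) w) \<Omega>\<^sub>2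
       (radial_cone (block (- I) b + \<tau> *\<^sub>R block (- I) w) \<Omega>\<^sub>2)"
    using radial_cone_second_order_tangent[OF \<Omega>\<^sub>2] by metis
  define \<tau> where "\<tau> = min (T0 / 2) (min T1 T2)"
  have \<tau>: "0 < \<tau>" "\<tau> < T0" "\<tau> \<le> T1" "\<tau> \<le> T2"
    using T0(1) T1(1) T2(1) by (auto simp: \<tau>_def min_def)
  define R where "R = radial_cone (b + \<tau> *\<^sub>R w) \<Omega>"
  define R1 where "R1 = radial_cone (block I (b + \<tau> *\<^sub>R w)) \<Omega>\<^sub>1"
  define R2 where "R2 = radial_cone (block (- I) (b + \<tau> *\<^sub>R w)) \<Omega>\<^sub>2"
  have R: "second_order_tangent b w \<Omega> R"
    unfolding R_def using T1(2) \<tau> by blast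
  have R2: "second_order_tangent (block (- I) b) (block (- I) w) \<Omega>\<^sub>2 R2"
    unfolding R2_def block_add block_scaleR using T2(2) \<tau> by blast
  have "closed R2"
    unfolding R2_def by (intro finite_union_polyhedra_closed finite_union_polyhedra_radial_cone \<Omega>\<^sub>2)
  have mem_R: "y \<in> R \<longleftrightarrow> block I y \<in> R1 \<and> block (- I) y \<in> R2" for y
    unfolding R_def R1_def R2_def \<Omega>_eq by (rule radial_cone_splitting)
  have "0 \<in> R"
    using T0(2) \<tau> by (simp add: R_def)
  define p where "p = Blinfun (block (- I) :: real^'m \<Rightarrow> real^'m)"
  have bl: "bounded_linear (block (- I) :: real^'m \<Rightarrow> real^'m)"
    by (simp add: linear_block flip: linear_conv_bounded_linear)
  have p: "blinfun_apply p = block (- I)"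
    unfolding p_def by (rule bounded_linear_Blinfun_apply[OF bl])
  have "\<exists>\<kappa>. \<forall>v. \<forall>z\<in>R2. \<exists>v'. (p o\<^sub>L F' xbar) v' + (1/2) *\<^sub>R (p o\<^sub>L F'' u) u \<in> R2 \<and>
      norm (v' - v) \<le> \<kappa> * norm ((p o\<^sub>L F' xbar) v + (1/2) *\<^sub>R (p o\<^sub>L F'' u) u - z)"
  proof (rule subregular_second_order_error_bound[where G' = "\<lambda>y. p o\<^sub>L F' y" and G'' = "\<lambda>h. p o\<^sub>L F'' h"
        and G = "\<lambda>x. block (- I) (F x)" and C = \<Omega>\<^sub>2])
    show "\<forall>\<^sub>F y in nhds xbar. ((\<lambda>x. block (- I) (F x)) has_derivative blinfun_apply (p o\<^sub>L F' y)) (at y)"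
      using F'
    proof eventually_elim
      case (elim y)
      show ?case
        by (rule has_derivative_eq_rhs[OF bounded_linear.has_derivative[OF bl elim]])
          (simp add: fun_eq_iff p)
    qed
    show "((\<lambda>y. p o\<^sub>L F' y) has_derivative (\<lambda>h. p o\<^sub>L F'' h)) (at xbar)"
      by (rule bounded_linear.has_derivative[OF
            bounded_bilinear.bounded_linear_right[OF bounded_bilinear_blinfun_compose] F''])
    show "continuous_on UNIV (\<lambda>x. block (- I) (F x))"
      by (rule bounded_linear.continuous_on[OF bl cont])
    show "second_order_tangent (block (- I) (F xbar)) ((p o\<^sub>L F' xbar) u) \<Omega>\<^sub>2 R2"
      using R2 by (simp add: b_def w_def p)
  qed (use sub u(2) \<open>closed R2\<close> finite_union_polyhedra_closed[OF \<Omega>\<^sub>2] in auto)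
  then obtain \<kappa> where \<kappa>: "\<And>v z. z \<in> R2 \<Longrightarrow> \<exists>v'. block (- I) (F' xbar v' + q) \<in> R2 \<and>
      norm (v' - v) \<le> \<kappa> * norm (block (- I) (F' xbar v + q) - z)"
    by (auto simp: p q_def block_add block_scaleR)
  have error_bound: "\<forall>v. \<forall>z\<in>R. \<exists>v' z'. z' \<in> R \<and> block I z' = block I z \<and>
          block (- I) z' = block (- I) (F' xbar v' + q) \<and>
          norm (v' - v) \<le> \<kappa> * norm (block (- I) (F' xbar v + q - z))"
  proof (intro allI ballI)
    fix v z assume "z \<in> R"
    then obtain v' where v': "block (- I) (F' xbar v' + q) \<in> R2"
      "norm (v' - v) \<le> \<kappa> * norm (block (- I) (F' xbar v + q) - block (- I) z)"
      using \<kappa> mem_R by blast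
    \<comment> \<open>Glue the first block of \<open>z\<close> to the solvable second block; the
      result stays in \<open>R\<close> because membership in \<open>R\<close> is decided
      blockwise.\<close>
    define z' where "z' = block I z + block (- I) (F' xbar v' + q)"
    have "block I z' = block I z" "block (- I) z' = block (- I) (F' xbar v' + q)"
      by (simp_all add: z'_def block_add)
    moreover have "z' \<in> R"
      using \<open>z \<in> R\<close> v'(1) by (simp add: mem_R calculation)
    ultimately show "\<exists>v' z'. z' \<in> R \<and> block I z' = block I z \<and>
          block (- I) z' = block (- I) (F' xbar v' + q) \<and>
          norm (v' - v) \<le> \<kappa> * norm (block (- I) (F' xbar v + q - z))"
      using v'(2) by (metis block_diff)
  qed
  \<comment> \<open>If the objective already decreases to first order, the constraint system alone
    is infeasible. The objective data are then zeroed, which also forces \<open>lam0 = 0\<close>, so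
    the result is a multiplier for the original Lagrangian.\<close>
  define c where "c = (if f' xbar u < 0 then 0 else gradient f xbar)"
  define q0 where "q0 = (if f' xbar u < 0 then 0 else f'' u u / 2)"
  have infeasible: "\<forall>v. F' xbar v + q \<in> R \<longrightarrow> c \<bullet> v + q0 > 0"
  proof (intro allI impI)
    fix v assume v: "F' xbar v + q \<in> R"
    have "\<not> (f' xbar u < 0 \<or> f' xbar u = 0 \<and> f' xbar v + f'' u u / 2 \<le> 0)"
      using essential_minimizer_no_descent_arc[OF f' f'' F' F'' ess, of u R v] R v u(2)
      by (auto simp: b_def w_def q_def)
    then show "c \<bullet> v + q0 > 0"
      using fu by (auto simp: c_def q0_def grad)
  qed
  obtain \<P> where \<P>: "finite \<P>" "R = \<Union>\<P>" "\<forall>P\<in>\<P>. polyhedron P \<and> cone P"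
    using radial_cone_finite_union_polyhedral_cones[OF \<Omega>(1)] unfolding R_def by metis
  have "linear (blinfun_apply (F' xbar))"
    by (simp add: blinfun.bounded_linear_right bounded_linear.linear)
  moreover have "\<Union>\<P> \<noteq> {}"
    using \<open>0 \<in> R\<close> \<P>(2) by blast
  ultimately obtain z lam0 lam M where *: "z \<in> R" "lam0 \<ge> 0"
    "\<forall>h. lam0 * (c \<bullet> h) + lam \<bullet> F' xbar h = 0" "lam0 * q0 + lam \<bullet> q > 0"
    "lam0 + norm (block I lam) \<noteq> 0"
    "\<forall>y\<in>R. lam \<bullet> (y - z) \<le> M * (norm (y - z))\<^sup>2"
    "c = 0 \<Longrightarrow> q0 = 0 \<Longrightarrow> lam0 = 0"
    using split_multiplier[OF _ \<P>(1,3) _ infeasible[unfolded \<P>(2)] error_bound[unfolded \<P>(2)]]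
    unfolding \<P>(2) by metis
  have lam0: "lam0 = 0" if "f' xbar u < 0"
    using *(7) that by (simp add: c_def q0_def)
  have "lam \<in> directional_normal_cone b \<Omega> w"
    using *(6) by (intro directional_normal_coneI[OF R *(1)]) blast
  moreover have "gradient (\<lambda>x. lagrangian f F x lam0 lam) xbar = 0"
  proof -
    have "lam0 * f' xbar h + lam \<bullet> F' xbar h = 0" for h
      using spec[OF *(3), of h] lam0 by (cases "f' xbar u < 0") (auto simp: c_def grad)
    then have "gradient (\<lambda>x. lagrangian f F x lam0 lam) xbar \<bullet> h = 0" for h
      by (simp add: lagrangian_derivatives(1)[OF f' f'' F' F''])
    then show ?thesis
      by (metis inner_eq_zero_iff)
  qed
  ultimately have "lam \<in> multipliers f F \<Omega> I lam0 xbar u"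
    using *(5) by (simp add: multipliers_def jac b_def w_def)
  moreover have "u \<bullet> (hessian (\<lambda>x. lagrangian f F x lam0 lam) xbar *v u) > 0"
    unfolding lagrangian_derivatives(2)[OF f' f'' F' F'']
    using *(4) lam0 by (cases "f' xbar u < 0") (auto simp: q0_def q_def)
  ultimately show ?thesis
    using *(2) by blast
qed

theorem theorem3p17:
  fixes f :: "real^'n \<Rightarrow> real"
    and F :: "real^'n \<Rightarrow> real^'m"
    and \<Omega> :: "(real^'m) set"
    and xbar :: "real^'n"
    and I :: "real^'n \<Rightarrow> 'm set"
  assumes "continuously_differentiable f"
    and "continuously_differentiable F"
    and "finite_union_polyhedra \<Omega>"
    and "F xbar \<in> \<Omega>"
    and "\<And>u. u \<in> linearized_cone F \<Omega> xbar \<Longrightarrow> admissible_splitting F \<Omega> xbar u (I u)"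
    and "twice_differentiable_at f xbar"
    and "twice_differentiable_at F xbar"
  shows "(essential_local_minimizer_second_order f F \<Omega> xbar \<longrightarrow>
            (\<forall>u\<in>critical_cone f F \<Omega> xbar. u \<noteq> 0 \<longrightarrow>
               (\<exists>lam0\<ge>0. \<exists>lam\<in>multipliers f F \<Omega> (I u) lam0 xbar u.
                  u \<bullet> (hessian (\<lambda>x. lagrangian f F x lam0 lam) xbar *v u) > 0)))
       \<and> ((\<forall>u\<in>critical_cone f F \<Omega> xbar. u \<noteq> 0 \<longrightarrow>
               (\<exists>lam0\<ge>0. \<exists>lam\<in>frechet_multipliers f F \<Omega> (I u) lam0 xbar u.
                  u \<bullet> (hessian (\<lambda>x. lagrangian f F x lam0 lam) xbar *v u) > 0))
          \<longrightarrow> essential_local_minimizer_second_order f F \<Omega> xbar)"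
proof -
  obtain f' f'' where f: "\<forall>\<^sub>F y in nhds xbar. (f has_derivative blinfun_apply (f' y)) (at y)"
    "(f' has_derivative f'') (at xbar)"
    using assms(6) unfolding twice_differentiable_at_def differentiable_def by blast
  obtain F' F'' where F: "\<forall>\<^sub>F y in nhds xbar. (F has_derivative blinfun_apply (F' y)) (at y)"
    "(F' has_derivative F'') (at xbar)"
    using assms(7) unfolding twice_differentiable_at_def differentiable_def by blast
  have cont: "continuous_on UNIV F"
    using assms(2) unfolding continuously_differentiable_def
    by (meson continuous_at_imp_continuous_on has_derivative_continuous)
  show ?thesis
  proof (intro conjI impI ballI)
    fix u assume "essential_local_minimizer_second_order f F \<Omega> xbar"
      and u: "u \<in> critical_cone f F \<Omega> xbar" "u \<noteq> 0"
    moreover have "admissible_splitting F \<Omega> xbar u (I u)"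
      using u(1) by (intro assms(5)) (simp add: critical_cone_def)
    ultimately show "\<exists>lam0\<ge>0. \<exists>lam\<in>multipliers f F \<Omega> (I u) lam0 xbar u.
        u \<bullet> (hessian (\<lambda>x. lagrangian f F x lam0 lam) xbar *v u) > 0"
      by (intro multipliers_necessary[OF f F cont assms(3,4)])
  next
    assume "\<forall>u\<in>critical_cone f F \<Omega> xbar. u \<noteq> 0 \<longrightarrow>
      (\<exists>lam0\<ge>0. \<exists>lam\<in>frechet_multipliers f F \<Omega> (I u) lam0 xbar u.
        u \<bullet> (hessian (\<lambda>x. lagrangian f F x lam0 lam) xbar *v u) > 0)"
    then show "essential_local_minimizer_second_order f F \<Omega> xbar"
      by (intro frechet_multipliers_sufficient[OF f F assms(3,4), where I = I]) blast
  qed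
qed

end
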